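(* Let $P=\{x\in\mathbb{R}^n_{\ge 0} : Ax\le \mathbf{1}\}$ be a polytope contained in $[0,1]^n$, where $A \in \mathbb{R}_{\ge 0}^{m\times n}$. For each fixed $\varepsilon\in(0,1/2)$ and $t\in\mathbb{Z}_{\ge 1}$, there exists a polyhedral relaxation $Q$ of the integer hull of $P$, which is a $(1+\varepsilon)^t$-approximation of the $t$-th Gomory closure $P^{(t)}$ of $P$ and has a linear extended formulation of size $(nm)^{(1/\varepsilon)^{O(t)}}$.
   Context: $\mathbf 1$ is the all-ones vector. $P_I=\operatorname{conv}(P\cap\mathbb{Z}^n)$ is the integer hull of $P$. A relaxation of $P_I$ is a set $Q\subseteq\mathbb{R}^n$ with $P_I\subseteq Q$; it is polyhedral if $Q$ is a polyhedron. Gomory closure: for a polyhedron $P$, the first closure $P'$ is the intersection of $P$ with all half-spaces $\{x: c^\intercal x\le\lfloor\delta\rfloor\}$, over all $c\in\mathbb{Z}^n$ and $\delta\in\mathbb{R}$ such that $c^\intercal x\le\delta$ is valid for $P$ (satisfied by all $x \in P$). Set $P^{(0)}=P$ and $P^{(t)}=(P^{(t-1)})'$. For $\alpha\ge 1$, $\alpha S=\{\alpha x: x\in S\}$; a relaxation $Q$ of $P_I$ is an $\alpha$-approximation of $P^{(t)}$ if $Q\subseteq\alpha P^{(t)}$. A linear extended formulation of $Q\subseteq\mathbb{R}^n$ is a polyhedron $E=\{(x,y)\in\mathbb{R}^{n+\ell}: Cx+Dy\le d\}$ whose projection to the $x$-coordinates is $Q$; a size bound means that the number $\ell$ of additional variables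 and the number of constraints in $Cx+Dy\le d$ are both bounded by the stated quantity. The constant hidden in $O(t)$ is absolute.
   Formalization: The base nm of the size bound is replaced by max(2, nm): for n = m = 1 the stated bound equals 1, yet a nonempty bounded Q in R is never the projection of a single inequality (e.g. A = (2), where Q = {0}). For nm ≥ 2 the bound is as stated. *)

theory Defs
  imports Complex_Main "Jordan_Normal_Form.Matrix"
begin

text \<open>The dimension is quantified inside the statement (below an absolute constant), so
  points of $R^n$ are elements of \<open>carrier_vec n\<close> rather than of a type of fixed dimension.
  On vectors and matrices, \<open>\<le>\<close> is the componentwise order between objects of equal dimension.\<close>

abbreviation ones_vec :: "nat \<Rightarrow> real vec" where
  "ones_vec n \<equiv> vec n (\<lambda>_. 1)"

definition polyhedron :: "nat \<Rightarrow> real vec set \<Rightarrow> bool" where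
  "polyhedron n S \<longleftrightarrow>
     (\<exists>k. \<exists>M \<in> carrier_mat k n. \<exists>b \<in> carrier_vec k. S = {x \<in> carrier_vec n. M *\<^sub>v x \<le> b})"

definition unit_cube :: "nat \<Rightarrow> real vec set" where
  "unit_cube n = {x \<in> carrier_vec n. 0\<^sub>v n \<le> x \<and> x \<le> ones_vec n}"

definition packing_polyhedron :: "real mat \<Rightarrow> real vec set" where
  "packing_polyhedron A =
     {x \<in> carrier_vec (dim_col A). 0\<^sub>v (dim_col A) \<le> x \<and> A *\<^sub>v x \<le> ones_vec (dim_row A)}"

definition int_vecs :: "nat \<Rightarrow> real vec set" where
  "int_vecs n = {c \<in> carrier_vec n. \<forall>i<n. c $ i \<in> \<int>}"

definition conv_hull :: "nat \<Rightarrow> real vec set \<Rightarrow> real vec set" where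
  "conv_hull n S = {vec n (\<lambda>i. \<Sum>v\<in>V. u v * v $ i) | V u.
     finite V \<and> V \<subseteq> S \<and> (\<forall>v\<in>V. 0 \<le> u v) \<and> sum u V = (1::real)}"

definition integer_hull :: "nat \<Rightarrow> real vec set \<Rightarrow> real vec set" where
  "integer_hull n P = conv_hull n (P \<inter> int_vecs n)"

definition gomory_closure :: "nat \<Rightarrow> real vec set \<Rightarrow> real vec set" where
  "gomory_closure n P =
     {x \<in> P. \<forall>c \<in> int_vecs n. \<forall>\<delta>::real. (\<forall>y\<in>P. c \<bullet> y \<le> \<delta>) \<longrightarrow> c \<bullet> x \<le> of_int \<lfloor>\<delta>\<rfloor>}"

definition iterated_gomory_closure :: "nat \<Rightarrow> nat \<Rightarrow> real vec set \<Rightarrow> real vec set" where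
  "iterated_gomory_closure n t P = (gomory_closure n ^^ t) P"

definition polyhedral_relaxation :: "nat \<Rightarrow> real vec set \<Rightarrow> real vec set \<Rightarrow> bool" where
  "polyhedral_relaxation n P Q \<longleftrightarrow> polyhedron n Q \<and> integer_hull n P \<subseteq> Q"

definition approximates :: "real \<Rightarrow> real vec set \<Rightarrow> real vec set \<Rightarrow> bool" where
  "approximates \<alpha> Q S \<longleftrightarrow> Q \<subseteq> (\<lambda>x. \<alpha> \<cdot>\<^sub>v x) ` S"

text \<open>Here \<open>l\<close> counts the additional variables and \<open>k\<close> the constraints.
  A bound of the form \<open>(n * m) powr e\<close> is meant asymptotically: for \<open>n = m = 1\<close> it is \<open>1\<close>
  whatever \<open>e\<close> is, and already a one-point subset of the line has no extended formulation with
  a single inequality. The base \<open>max 2 (n * m)\<close> differs from \<open>n * m\<close> only when \<open>n * m < 2\<close>.\<close>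

definition has_extended_formulation :: "nat \<Rightarrow> real vec set \<Rightarrow> real \<Rightarrow> bool" where
  "has_extended_formulation n Q s \<longleftrightarrow>
     (\<exists>l k. real l \<le> s \<and> real k \<le> s \<and>
       (\<exists>C \<in> carrier_mat k n. \<exists>D \<in> carrier_mat k l. \<exists>d \<in> carrier_vec k.
          Q = {x \<in> carrier_vec n. \<exists>y \<in> carrier_vec l. C *\<^sub>v x + D *\<^sub>v y \<le> d}))"

end

theory Submission
  imports Defs
begin

text \<open>For a cut \<open>c \<bullet> x \<le> k\<close> of the \<open>t\<close>-th closure with \<open>k \<ge> 1 / \<epsilon>\<close>, rounding the right-hand side
  down costs only a factor \<open>1 + \<epsilon>\<close>, so only the cuts with \<open>k < 1 / \<epsilon>\<close> need work. The relaxation is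
  the root of a branching tree of depth \<open>d\<close>: for every row of \<open>A\<close>, a node is a sum of (scaled) children,
  one for each guess of which of the entries of that row larger than \<open>\<theta>\<close> are set to 1, the others
  of these being set to 0. The \<open>s\<close>-th closure contains \<open>P\<close> scaled down by \<open>2 ^ s\<close> (up to coordinates
  that vanish at all integer points), so \<open>c\<close> is bounded on \<open>P\<close> by \<open>M = 2 ^ t / \<epsilon>\<close>, and therefore some
  row carries a \<open>\<theta>\<close>-fraction of the value of \<open>c\<close> on its large entries. Branching on this row either
  fixes an item of the support of \<open>c\<close> to 1, which happens at most \<open>k\<close> times because integer points
  satisfy the cut, or removes this fraction of the value. Hence \<open>c \<bullet> x \<le> k + \<epsilon>\<close> at the root for a
  depth polynomial in \<open>2 ^ t / \<epsilon>\<close>.\<close>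

subsection \<open>Affine systems and their projections\<close>

text \<open>The coefficients stay under the quantifier, so that constraints can be written as plain
  functions of an assignment whose variables are indexed by tree nodes. Matrices are extracted from
  them only in \<open>solution_shadow_matrix\<close>.\<close>

definition affine_on :: "'v set \<Rightarrow> (('v \<Rightarrow> real) \<Rightarrow> real) \<Rightarrow> bool" where
  "affine_on V L \<longleftrightarrow> (\<exists>a b. \<forall>y. L y = b + (\<Sum>v\<in>V. a v * y v))"

lemma affine_on_const: "affine_on V (\<lambda>y. b)"
  unfolding affine_on_def by (rule exI[of _ "\<lambda>_. 0"], rule exI[of _ b]) simp

lemma affine_on_coord: "finite V \<Longrightarrow> v \<in> V \<Longrightarrow> affine_on V (\<lambda>y. y v)"
  unfolding affine_on_def
  by (rule exI[of _ "\<lambda>w. if w = v then 1 else 0"], rule exI[of _ 0])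
    (simp add: if_distrib[of "\<lambda>z. z * _"] sum.delta' cong: if_cong)

lemma affine_on_add:
  assumes "affine_on V L" "affine_on V M"
  shows "affine_on V (\<lambda>y. L y + M y)"
proof -
  obtain a b a' b' where "\<And>y. L y = b + (\<Sum>v\<in>V. a v * y v)" "\<And>y. M y = b' + (\<Sum>v\<in>V. a' v * y v)"
    using assms unfolding affine_on_def by blast
  then show ?thesis
    unfolding affine_on_def
    by (intro exI[of _ "\<lambda>v. a v + a' v"] exI[of _ "b + b'"]) (simp add: algebra_simps sum.distrib)
qed

lemma affine_on_scale:
  assumes "affine_on V L"
  shows "affine_on V (\<lambda>y. r * L y)"
proof -
  obtain a b where "\<And>y. L y = b + (\<Sum>v\<in>V. a v * y v)"
    using assms unfolding affine_on_def by blast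
  then show ?thesis
    unfolding affine_on_def
    by (intro exI[of _ "\<lambda>v. r * a v"] exI[of _ "r * b"])
      (simp add: algebra_simps sum_distrib_left)
qed

lemma affine_on_uminus: "affine_on V L \<Longrightarrow> affine_on V (\<lambda>y. - L y)"
  using affine_on_scale[of V L "-1"] by simp

lemma affine_on_diff: "affine_on V L \<Longrightarrow> affine_on V M \<Longrightarrow> affine_on V (\<lambda>y. L y - M y)"
  using affine_on_add[of V L "\<lambda>y. - M y"] affine_on_uminus[of V M] by simp

lemma affine_on_sum: "(\<And>i. i \<in> I \<Longrightarrow> affine_on V (L i)) \<Longrightarrow> affine_on V (\<lambda>y. \<Sum>i\<in>I. L i y)"
  by (induction I rule: infinite_finite_induct) (auto intro: affine_on_const affine_on_add)

lemmas affine_on_intros = affine_on_const affine_on_coord affine_on_add affine_on_scale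
  affine_on_uminus affine_on_diff affine_on_sum

lemma affine_on_cong:
  assumes "affine_on V L" "\<And>v. v \<in> V \<Longrightarrow> y v = z v"
  shows "L y = L z"
proof -
  obtain a b where "\<And>y. L y = b + (\<Sum>v\<in>V. a v * y v)"
    using assms(1) unfolding affine_on_def by blast
  then show ?thesis using assms(2) by simp
qed

section \<open>Fourier-Motzkin elimination\<close>

lemma separate_finite_reals:
  fixes A B :: "real set"
  assumes "finite A" "finite B" "\<And>a b. a \<in> A \<Longrightarrow> b \<in> B \<Longrightarrow> a \<le> b"
  shows "\<exists>r. (\<forall>a\<in>A. a \<le> r) \<and> (\<forall>b\<in>B. r \<le> b)"
proof (cases "A = {}")
  case True
  show ?thesis
  proof (cases "B = {}")
    case False
    then show ?thesis using True assms(2) by (intro exI[of _ "Min B"]) auto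
  qed (use True in auto)
next
  case False
  then show ?thesis using assms by (intro exI[of _ "Max A"]) auto
qed

text \<open>With the other variables fixed, each constraint bounds \<open>v\<close> from above, from
  below, or not at all. A value for \<open>v\<close> exists iff every lower bound is at most every
  upper bound and the constraints free of \<open>v\<close> hold; multiplied out, these comparisons
  are affine in the other variables.\<close>

lemma fourier_motzkin_step:
  assumes "finite V" "v \<notin> V" "finite C" "\<And>L. L \<in> C \<Longrightarrow> affine_on (insert v V) L"
  shows "\<exists>C'. finite C' \<and> (\<forall>L\<in>C'. affine_on V L) \<and>
    (\<forall>y. (\<exists>r. \<forall>L\<in>C. L (y(v := r)) \<le> 0) \<longleftrightarrow> (\<forall>L\<in>C'. L y \<le> 0))"
proof -
  \<comment> \<open>The pair \<open>p\<close> holds the coefficient of \<open>v\<close> and the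
    remaining affine functional.\<close>
  have "\<exists>p. affine_on V (snd p) \<and> (\<forall>y r. L (y(v := r)) = fst p * r + snd p y)" if L: "L \<in> C" for L
  proof -
    obtain a b where ab: "\<And>y. L y = b + (\<Sum>w\<in>insert v V. a w * y w)"
      using assms(4)[OF L] unfolding affine_on_def by blast
    have "(\<Sum>w\<in>V. a w * (y(v := r)) w) = (\<Sum>w\<in>V. a w * y w)" for y r
      using assms(2) by (intro sum.cong) auto
    then have "L (y(v := r)) = a v * r + (b + (\<Sum>w\<in>V. a w * y w))" for y r
      using assms(1,2) by (simp add: ab)
    moreover have "affine_on V (\<lambda>y. b + (\<Sum>w\<in>V. a w * y w))"
      unfolding affine_on_def by blast
    ultimately show ?thesis by (intro exI[of _ "(a v, \<lambda>y. b + (\<Sum>w\<in>V. a w * y w))"]) simp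
  qed
  then have "\<forall>L\<in>C. \<exists>p. affine_on V (snd p) \<and> (\<forall>y r. L (y(v := r)) = fst p * r + snd p y)"
    by blast
  from bchoice[OF this] obtain p where p: "\<And>L. L \<in> C \<Longrightarrow> affine_on V (snd (p L))"
    "\<And>L y r. L \<in> C \<Longrightarrow> L (y(v := r)) = fst (p L) * r + snd (p L) y"
    by blast
  define \<alpha> where "\<alpha> L = fst (p L)" for L
  define N where "N L = snd (p L)" for L
  have N: "\<And>L. L \<in> C \<Longrightarrow> affine_on V (N L)"
    and LN: "\<And>L y r. L \<in> C \<Longrightarrow> L (y(v := r)) = \<alpha> L * r + N L y"
    using p by (auto simp: \<alpha>_def N_def)
  define Z where "Z = {L \<in> C. \<alpha> L = 0}"
  define U where "U = {L \<in> C. \<alpha> L > 0}"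
  define D where "D = {L \<in> C. \<alpha> L < 0}"
  \<comment> \<open>The multipliers \<open>\<alpha> L\<close> and \<open>- \<alpha> M\<close> are
    positive, so this is a nonnegative combination of the two constraints, and the terms in
    \<open>r\<close> cancel.\<close>
  define C' where "C' = N ` Z \<union> (\<lambda>(L, M) y. \<alpha> L * N M y - \<alpha> M * N L y) ` (U \<times> D)"
  have fin: "finite Z" "finite U" "finite D" using assms(3) by (auto simp: Z_def U_def D_def)
  have "finite C'" using fin by (simp add: C'_def)
  moreover have "\<forall>L\<in>C'. affine_on V L"
    by (auto simp: C'_def Z_def U_def D_def intro!: N affine_on_diff affine_on_scale)
  moreover have "(\<exists>r. \<forall>L\<in>C. L (y(v := r)) \<le> 0) \<longleftrightarrow> (\<forall>L\<in>C'. L y \<le> 0)" for y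
  proof
    assume "\<exists>r. \<forall>L\<in>C. L (y(v := r)) \<le> 0"
    then obtain r where r: "\<And>L. L \<in> C \<Longrightarrow> \<alpha> L * r + N L y \<le> 0" by (auto simp: LN)
    have "\<alpha> L * N M y - \<alpha> M * N L y \<le> 0" if "L \<in> U" "M \<in> D" for L M
    proof -
      have "\<alpha> L * (\<alpha> M * r + N M y) \<le> 0" "(- \<alpha> M) * (\<alpha> L * r + N L y) \<le> 0"
        using that r by (auto simp: U_def D_def intro!: mult_nonneg_nonpos mult_nonpos_nonpos)
      then have "\<alpha> L * (\<alpha> M * r + N M y) + (- \<alpha> M) * (\<alpha> L * r + N L y) \<le> 0" by linarith
      then show ?thesis by (simp add: algebra_simps)
    qed
    moreover have "N L y \<le> 0" if "L \<in> Z" for L using r[of L] that by (auto simp: Z_def)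
    ultimately show "\<forall>L\<in>C'. L y \<le> 0" by (auto simp: C'_def)
  next
    assume c: "\<forall>L\<in>C'. L y \<le> 0"
    have ZZ: "N L y \<le> 0" if "L \<in> Z" for L using c that by (auto simp: C'_def)
    have UD: "\<alpha> L * N M y - \<alpha> M * N L y \<le> 0" if "L \<in> U" "M \<in> D" for L M
      using c that by (force simp: C'_def)
    have "\<exists>r. (\<forall>a\<in>(\<lambda>M. N M y / (- \<alpha> M)) ` D. a \<le> r) \<and> (\<forall>b\<in>(\<lambda>L. - N L y / \<alpha> L) ` U. r \<le> b)"
    proof (rule separate_finite_reals)
      fix a b assume "a \<in> (\<lambda>M. N M y / (- \<alpha> M)) ` D" "b \<in> (\<lambda>L. - N L y / \<alpha> L) ` U"
      then obtain M L where *: "M \<in> D" "L \<in> U" "a = N M y / (- \<alpha> M)" "b = - N L y / \<alpha> L" by blast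
      then have "\<alpha> M < 0" "\<alpha> L > 0" by (auto simp: U_def D_def)
      then show "a \<le> b" using UD[OF *(2,1)] unfolding *(3,4) by (simp add: field_simps)
    qed (use fin in auto)
    then obtain r where r: "\<And>M. M \<in> D \<Longrightarrow> N M y / (- \<alpha> M) \<le> r" "\<And>L. L \<in> U \<Longrightarrow> r \<le> - N L y / \<alpha> L"
      by auto
    have "\<alpha> L * r + N L y \<le> 0" if "L \<in> C" for L
    proof -
      have "L \<in> Z \<or> L \<in> U \<or> L \<in> D"
        using that by (auto simp: Z_def U_def D_def)
      then consider "L \<in> Z" | "L \<in> U" | "L \<in> D" by blast
      then show ?thesis
      proof cases
        case 1 then show ?thesis using ZZ by (auto simp: Z_def)
      next
        case 2
        then have "\<alpha> L > 0" by (auto simp: U_def)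
        then show ?thesis using r(2)[OF 2] by (simp add: field_simps)
      next
        case 3
        then have "\<alpha> L < 0" by (auto simp: D_def)
        then show ?thesis using r(1)[OF 3] by (simp add: field_simps)
      qed
    qed
    then show "\<exists>r. \<forall>L\<in>C. L (y(v := r)) \<le> 0" by (auto simp: LN)
  qed
  ultimately show ?thesis by blast
qed

text \<open>The relaxation arises as a projection, whereas \<open>polyhedron\<close> asks for a
  system in the coordinates of the space alone; \<open>W\<close> collects the variables to be
  eliminated.\<close>

lemma fourier_motzkin:
  assumes "finite W" "finite V" "V \<inter> W = {}" "finite C" "\<And>L. L \<in> C \<Longrightarrow> affine_on (V \<union> W) L"
  shows "\<exists>C'. finite C' \<and> (\<forall>L\<in>C'. affine_on V L) \<and>
    (\<forall>y. (\<exists>z. (\<forall>v\<in>V. z v = y v) \<and> (\<forall>L\<in>C. L z \<le> 0)) \<longleftrightarrow> (\<forall>L\<in>C'. L y \<le> 0))"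
  using assms
proof (induction W arbitrary: C rule: finite_induct)
  case empty
  have "L z = L y" if "L \<in> C" "\<forall>v\<in>V. z v = y v" for L z y
    using affine_on_cong[of V L z y] empty.prems(4)[OF that(1)] that(2) by simp
  then have "(\<forall>L\<in>C. L z \<le> 0) \<longleftrightarrow> (\<forall>L\<in>C. L y \<le> 0)" if "\<forall>v\<in>V. z v = y v" for z y
    using that by (metis (no_types))
  then have "(\<exists>z. (\<forall>v\<in>V. z v = y v) \<and> (\<forall>L\<in>C. L z \<le> 0)) \<longleftrightarrow> (\<forall>L\<in>C. L y \<le> 0)" for y
    by blast
  then show ?case using empty.prems by (intro exI[of _ C]) auto
next
  case (insert w W)
  have "\<exists>C1. finite C1 \<and> (\<forall>L\<in>C1. affine_on (V \<union> W) L) \<and>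
    (\<forall>y. (\<exists>r. \<forall>L\<in>C. L (y(w := r)) \<le> 0) \<longleftrightarrow> (\<forall>L\<in>C1. L y \<le> 0))"
    using insert.prems insert.hyps by (intro fourier_motzkin_step) auto
  then obtain C1 where C1: "finite C1" "\<And>L. L \<in> C1 \<Longrightarrow> affine_on (V \<union> W) L"
    "\<And>y. (\<exists>r. \<forall>L\<in>C. L (y(w := r)) \<le> 0) \<longleftrightarrow> (\<forall>L\<in>C1. L y \<le> 0)"
    by blast
  have "\<exists>C'. finite C' \<and> (\<forall>L\<in>C'. affine_on V L) \<and>
    (\<forall>y. (\<exists>z. (\<forall>v\<in>V. z v = y v) \<and> (\<forall>L\<in>C1. L z \<le> 0)) \<longleftrightarrow> (\<forall>L\<in>C'. L y \<le> 0))"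
    using insert.prems by (intro insert.IH C1) auto
  moreover have "(\<exists>z. (\<forall>v\<in>V. z v = y v) \<and> (\<forall>L\<in>C1. L z \<le> 0)) \<longleftrightarrow>
    (\<exists>z. (\<forall>v\<in>V. z v = y v) \<and> (\<forall>L\<in>C. L z \<le> 0))" (is "?l \<longleftrightarrow> ?r") for y
  proof
    assume ?l
    then obtain z r where "\<forall>v\<in>V. z v = y v" "\<forall>L\<in>C. L (z(w := r)) \<le> 0" using C1(3) by blast
    then show ?r using insert.prems(2) by (intro exI[of _ "z(w := r)"]) auto
  next
    assume ?r
    then obtain z where z: "\<forall>v\<in>V. z v = y v" "\<forall>L\<in>C. L z \<le> 0" by blast
    then have "\<forall>L\<in>C. L (z(w := z w)) \<le> 0" by simp
    then have "\<forall>L\<in>C1. L z \<le> 0" using C1(3) by blast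
    then show ?l using z(1) by blast
  qed
  ultimately show ?case by simp
qed

section \<open>Projections of affine systems as matrix inequalities\<close>

definition solution_shadow :: "nat \<Rightarrow> (nat \<Rightarrow> 'v) \<Rightarrow> (('v \<Rightarrow> real) \<Rightarrow> real) set \<Rightarrow> real vec set" where
  "solution_shadow n e C =
    {x \<in> carrier_vec n. \<exists>y. (\<forall>j<n. y (e j) = x $ j) \<and> (\<forall>L\<in>C. L y \<le> 0)}"

text \<open>Enumerating the constraints gives the rows, and enumerating the variables outside the
  image of \<open>e\<close> gives the columns of \<open>D\<close>. Any numbering will do, since only
  the cardinalities enter the size bound.\<close>

lemma solution_shadow_matrix:
  fixes e :: "nat \<Rightarrow> 'v"
  assumes "finite V" "inj_on e {..<n}" "e ` {..<n} \<subseteq> V" "finite C" "\<And>L. L \<in> C \<Longrightarrow> affine_on V L"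
  shows "\<exists>A \<in> carrier_mat (card C) n. \<exists>D \<in> carrier_mat (card C) (card V - n). \<exists>d \<in> carrier_vec (card C).
    solution_shadow n e C = {x \<in> carrier_vec n. \<exists>y \<in> carrier_vec (card V - n). A *\<^sub>v x + D *\<^sub>v y \<le> d}"
proof -
  define W where "W = V - e ` {..<n}"
  define l where "l = card V - n"
  define k where "k = card C"
  have fW: "finite W" using assms(1) by (simp add: W_def)
  have "card W = l"
    using assms(1-3) by (simp add: W_def l_def card_Diff_subset card_image)
  then obtain f where f: "bij_betw f {0..<l} W" using ex_bij_betw_nat_finite[OF fW] by blast
  obtain h where h: "bij_betw h {0..<k} C" using ex_bij_betw_nat_finite[OF assms(4)] k_def by blast
  have "\<exists>p. \<forall>y. L y = snd p + (\<Sum>v\<in>V. fst p v * y v)" if L: "L \<in> C" for L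
  proof -
    obtain a b where "\<forall>y. L y = b + (\<Sum>v\<in>V. a v * y v)"
      using assms(5)[OF L] unfolding affine_on_def by blast
    then show ?thesis by (intro exI[of _ "(a, b)"]) simp
  qed
  then have "\<forall>L\<in>C. \<exists>p. \<forall>y. L y = snd p + (\<Sum>v\<in>V. fst p v * y v)" by blast
  from bchoice[OF this] obtain p where
    p: "\<And>L y. L \<in> C \<Longrightarrow> L y = snd (p L) + (\<Sum>v\<in>V. fst (p L) v * y v)"
    by blast
  define A where "A = mat k n (\<lambda>(i, j). fst (p (h i)) (e j))"
  define D where "D = mat k l (\<lambda>(i, j). fst (p (h i)) (f j))"
  define d where "d = vec k (\<lambda>i. - snd (p (h i)))"
  have split: "(\<Sum>v\<in>V. q v) = (\<Sum>j<n. q (e j)) + (\<Sum>j<l. q (f j))" for q :: "'v \<Rightarrow> real"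
  proof -
    have "(\<Sum>v\<in>V. q v) = (\<Sum>v\<in>W. q v) + (\<Sum>v\<in>e ` {..<n}. q v)"
      unfolding W_def by (rule sum.subset_diff[OF assms(3,1)])
    moreover have "(\<Sum>v\<in>W. q v) = (\<Sum>j<l. q (f j))"
      using sum.reindex_bij_betw[OF f, of q] by (simp add: lessThan_atLeast0)
    ultimately show ?thesis by (simp add: sum.reindex[OF assms(2)])
  qed
  have sys: "(\<forall>L\<in>C. L y \<le> 0) \<longleftrightarrow> A *\<^sub>v vec n (\<lambda>j. y (e j)) + D *\<^sub>v vec l (\<lambda>j. y (f j)) \<le> d" for y
  proof -
    have "(\<forall>L\<in>C. L y \<le> 0) \<longleftrightarrow> (\<forall>i<k. h i y \<le> 0)"
      using h by (force simp: bij_betw_def)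
    also have "\<dots> \<longleftrightarrow> (\<forall>i<k. (\<Sum>j<n. fst (p (h i)) (e j) * y (e j)) + (\<Sum>j<l. fst (p (h i)) (f j) * y (f j))
        \<le> - snd (p (h i)))"
    proof (intro all_cong)
      fix i assume "i < k"
      then have "h i \<in> C" using h by (auto simp: bij_betw_def)
      from p[OF this] show "(h i y \<le> 0) \<longleftrightarrow> ((\<Sum>j<n. fst (p (h i)) (e j) * y (e j)) +
        (\<Sum>j<l. fst (p (h i)) (f j) * y (f j)) \<le> - snd (p (h i)))"
        by (simp add: split) linarith
    qed
    also have "\<dots> \<longleftrightarrow> A *\<^sub>v vec n (\<lambda>j. y (e j)) + D *\<^sub>v vec l (\<lambda>j. y (f j)) \<le> d"
      by (auto simp: less_eq_vec_def A_def D_def d_def scalar_prod_def lessThan_atLeast0)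
    finally show ?thesis .
  qed
  have "solution_shadow n e C = {x \<in> carrier_vec n. \<exists>y \<in> carrier_vec l. A *\<^sub>v x + D *\<^sub>v y \<le> d}"
  proof (intro equalityI subsetI)
    fix x assume "x \<in> solution_shadow n e C"
    then obtain y where x: "x \<in> carrier_vec n" "\<And>j. j < n \<Longrightarrow> y (e j) = x $ j" "\<forall>L\<in>C. L y \<le> 0"
      by (auto simp: solution_shadow_def)
    have "vec n (\<lambda>j. y (e j)) = x" using x(1,2) by (intro eq_vecI) auto
    then show "x \<in> {x \<in> carrier_vec n. \<exists>y \<in> carrier_vec l. A *\<^sub>v x + D *\<^sub>v y \<le> d}"
      using x(1,3) sys by (auto intro!: bexI[of _ "vec l (\<lambda>j. y (f j))"])
  next
    fix x assume "x \<in> {x \<in> carrier_vec n. \<exists>y \<in> carrier_vec l. A *\<^sub>v x + D *\<^sub>v y \<le> d}"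
    then obtain y where x: "x \<in> carrier_vec n" "y \<in> carrier_vec l" "A *\<^sub>v x + D *\<^sub>v y \<le> d" by auto
    \<comment> \<open>Glues \<open>x\<close> and \<open>y\<close> into one assignment: a variable in
      \<open>W\<close> reads its value from \<open>y\<close>, one in the image of \<open>e\<close>
      from \<open>x\<close>.\<close>
    define z where "z v = (if v \<in> W then y $ (inv_into {0..<l} f v) else x $ (inv_into {..<n} e v))" for v
    have ze: "z (e j) = x $ j" if "j < n" for j
      using that assms(2) by (auto simp: z_def W_def)
    have zf: "z (f j) = y $ j" if "j < l" for j
      using that f by (auto simp: z_def bij_betw_def)
    have "vec n (\<lambda>j. z (e j)) = x" "vec l (\<lambda>j. z (f j)) = y"
      using x(1,2) ze zf by (auto intro!: eq_vecI)
    then have "\<forall>L\<in>C. L z \<le> 0" using sys[of z] x(3) by simp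
    then show "x \<in> solution_shadow n e C" using x(1) ze by (auto simp: solution_shadow_def)
  qed
  moreover have "A \<in> carrier_mat k n" "D \<in> carrier_mat k l" "d \<in> carrier_vec k"
    by (auto simp: A_def D_def d_def)
  ultimately show ?thesis unfolding k_def l_def by blast
qed

lemma solution_shadow_extended_formulation:
  assumes "finite V" "inj_on e {..<n}" "e ` {..<n} \<subseteq> V" "finite C" "\<And>L. L \<in> C \<Longrightarrow> affine_on V L"
    and "real (card V) \<le> s" "real (card C) \<le> s"
  shows "has_extended_formulation n (solution_shadow n e C) s"
  unfolding has_extended_formulation_def
  using solution_shadow_matrix[OF assms(1-5)] assms(6,7)
  by (intro exI[of _ "card V - n"] exI[of _ "card C"]) auto

lemma solution_shadow_polyhedron:
  assumes "finite V" "inj_on e {..<n}" "e ` {..<n} \<subseteq> V" "finite C" "\<And>L. L \<in> C \<Longrightarrow> affine_on V L"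
  shows "polyhedron n (solution_shadow n e C)"
proof -
  define X where "X = e ` {..<n}"
  have X: "finite X" "card X = n" using assms(2) by (auto simp: X_def card_image)
  have "\<exists>C'. finite C' \<and> (\<forall>L\<in>C'. affine_on X L) \<and>
    (\<forall>y. (\<exists>z. (\<forall>v\<in>X. z v = y v) \<and> (\<forall>L\<in>C. L z \<le> 0)) \<longleftrightarrow> (\<forall>L\<in>C'. L y \<le> 0))"
    using assms X_def by (intro fourier_motzkin[of "V - X"]) (auto simp: Un_absorb1)
  then obtain C' where C': "finite C'" "\<And>L. L \<in> C' \<Longrightarrow> affine_on X L"
    "\<And>y. (\<exists>z. (\<forall>v\<in>X. z v = y v) \<and> (\<forall>L\<in>C. L z \<le> 0)) \<longleftrightarrow> (\<forall>L\<in>C'. L y \<le> 0)"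
    by blast
  have "(\<exists>y. (\<forall>j<n. y (e j) = x $ j) \<and> (\<forall>L\<in>C. L y \<le> 0)) \<longleftrightarrow>
      (\<exists>y. (\<forall>j<n. y (e j) = x $ j) \<and> (\<forall>L\<in>C'. L y \<le> 0))" for x :: "real vec"
  proof
    assume "\<exists>y. (\<forall>j<n. y (e j) = x $ j) \<and> (\<forall>L\<in>C. L y \<le> 0)"
    then show "\<exists>y. (\<forall>j<n. y (e j) = x $ j) \<and> (\<forall>L\<in>C'. L y \<le> 0)" using C'(3) by blast
  next
    assume "\<exists>y. (\<forall>j<n. y (e j) = x $ j) \<and> (\<forall>L\<in>C'. L y \<le> 0)"
    then obtain y z where "\<forall>j<n. y (e j) = x $ j" "\<forall>v\<in>X. z v = y v" "\<forall>L\<in>C. L z \<le> 0"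
      using C'(3) by blast
    then show "\<exists>y. (\<forall>j<n. y (e j) = x $ j) \<and> (\<forall>L\<in>C. L y \<le> 0)"
      by (intro exI[of _ z]) (auto simp: X_def)
  qed
  then have "solution_shadow n e C = solution_shadow n e C'" by (auto simp: solution_shadow_def)
  \<comment> \<open>After the elimination the variables are exactly the \<open>n\<close>
    coordinates, so the matrix form has no additional variables and \<open>D\<close> has no
    columns.\<close>
  moreover obtain A D d where A: "A \<in> carrier_mat (card C') n" "D \<in> carrier_mat (card C') 0"
    "d \<in> carrier_vec (card C')"
    "solution_shadow n e C' = {x \<in> carrier_vec n. \<exists>y \<in> carrier_vec 0. A *\<^sub>v x + D *\<^sub>v y \<le> d}"
    using solution_shadow_matrix[OF X(1) assms(2) _ C'(1,2)] X(2) by (auto simp: X_def)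
  moreover have "(\<exists>y \<in> carrier_vec 0. A *\<^sub>v x + D *\<^sub>v y \<le> d) \<longleftrightarrow> A *\<^sub>v x \<le> d"
    if "x \<in> carrier_vec n" for x
  proof -
    have "A *\<^sub>v x + D *\<^sub>v y = A *\<^sub>v x" if "y \<in> carrier_vec 0" for y
      using that \<open>x \<in> carrier_vec n\<close> A(1,2) by (intro eq_vecI) (auto simp: scalar_prod_def)
    then show ?thesis by (metis zero_carrier_vec)
  qed
  ultimately have "solution_shadow n e C = {x \<in> carrier_vec n. A *\<^sub>v x \<le> d}" by auto
  then show ?thesis using A unfolding polyhedron_def by blast
qed

text \<open>Linear inequalities survive convex combinations. Hence a polyhedron is a relaxation as
  soon as it contains the integer points.\<close>

lemma conv_hull_subset_polyhedron:
  assumes "polyhedron n Q" "S \<subseteq> Q"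
  shows "conv_hull n S \<subseteq> Q"
proof
  fix x assume "x \<in> conv_hull n S"
  then obtain V u where V: "finite V" "V \<subseteq> S" "\<And>v. v \<in> V \<Longrightarrow> 0 \<le> u v" "sum u V = (1::real)"
    and x: "x = vec n (\<lambda>i. \<Sum>v\<in>V. u v * v $ i)"
    unfolding conv_hull_def by blast
  obtain k M b where M: "M \<in> carrier_mat k n" "b \<in> carrier_vec k"
    and Q: "Q = {x \<in> carrier_vec n. M *\<^sub>v x \<le> b}"
    using assms(1) unfolding polyhedron_def by blast
  have "(\<Sum>j<n. M $$ (i, j) * (\<Sum>v\<in>V. u v * v $ j)) \<le> b $ i" if i: "i < k" for i
  proof -
    have "(\<Sum>j<n. M $$ (i, j) * (\<Sum>v\<in>V. u v * v $ j)) = (\<Sum>v\<in>V. u v * (\<Sum>j<n. M $$ (i, j) * v $ j))"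
      unfolding sum_distrib_left by (subst sum.swap) (simp add: algebra_simps)
    also have "\<dots> \<le> (\<Sum>v\<in>V. u v * b $ i)"
    proof (intro sum_mono mult_left_mono)
      fix v assume "v \<in> V"
      then have "v \<in> carrier_vec n" "M *\<^sub>v v \<le> b" using V(2) assms(2) Q by auto
      then show "(\<Sum>j<n. M $$ (i, j) * v $ j) \<le> b $ i"
        using M i by (auto simp: less_eq_vec_def scalar_prod_def lessThan_atLeast0)
    qed (use V in auto)
    also have "\<dots> = b $ i" using V(4) by (simp flip: sum_distrib_right)
    finally show ?thesis .
  qed
  then show "x \<in> Q"
    using M unfolding Q x by (auto simp: less_eq_vec_def scalar_prod_def lessThan_atLeast0)
qed

subsection \<open>Gomory closures of down-closed sets\<close>

lemma iterated_gomory_closure_0: "iterated_gomory_closure n 0 P = P"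
  by (simp add: iterated_gomory_closure_def)

lemma iterated_gomory_closure_Suc:
  "iterated_gomory_closure n (Suc t) P = gomory_closure n (iterated_gomory_closure n t P)"
  by (simp add: iterated_gomory_closure_def)

lemma scalar_prod_lessThan: "x \<in> carrier_vec n \<Longrightarrow> c \<bullet> x = (\<Sum>j<n. c $ j * x $ j)"
  by (auto simp: scalar_prod_def lessThan_atLeast0)

text \<open>Packing polyhedra have this property and Gomory closures inherit it. It is what allows
  attention to be restricted to cuts with nonnegative coefficients.\<close>

definition down_closed :: "nat \<Rightarrow> real vec set \<Rightarrow> bool" where
  "down_closed n S \<longleftrightarrow> (\<forall>x\<in>S. x \<in> carrier_vec n \<and> (\<forall>j<n. 0 \<le> x $ j)) \<and>
     (\<forall>x\<in>S. \<forall>y \<in> carrier_vec n. (\<forall>j<n. 0 \<le> y $ j \<and> y $ j \<le> x $ j) \<longrightarrow> y \<in> S)"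

lemma down_closedD:
  assumes "down_closed n S" "x \<in> S"
  shows "x \<in> carrier_vec n" "\<And>j. j < n \<Longrightarrow> 0 \<le> x $ j"
    "\<And>y. y \<in> carrier_vec n \<Longrightarrow> (\<And>j. j < n \<Longrightarrow> 0 \<le> y $ j) \<Longrightarrow> (\<And>j. j < n \<Longrightarrow> y $ j \<le> x $ j) \<Longrightarrow> y \<in> S"
  using assms unfolding down_closed_def by (blast, blast, metis)

lemma gomory_closure_subset: "gomory_closure n P \<subseteq> P"
  by (auto simp: gomory_closure_def)

text \<open>Dropping the negative coefficients, and those outside \<open>J\<close>, keeps a cut
  valid on a down-closed set and does not weaken it at nonnegative points that vanish outside
  \<open>J\<close>.\<close>

definition clip :: "nat \<Rightarrow> nat set \<Rightarrow> real vec \<Rightarrow> real vec" where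
  "clip n J c = vec n (\<lambda>j. if j \<in> J \<and> 0 < c $ j then c $ j else 0)"

lemma clip_int_vecs: "c \<in> int_vecs n \<Longrightarrow> clip n J c \<in> int_vecs n"
  by (auto simp: clip_def int_vecs_def)

text \<open>Setting the dropped coordinates of \<open>y\<close> to 0 stays inside \<open>S\<close>,
  and at the new point \<open>c\<close> has the value that the clipped vector has at
  \<open>y\<close>.\<close>

lemma clip_valid:
  assumes "down_closed n S" "\<And>y. y \<in> S \<Longrightarrow> c \<bullet> y \<le> \<delta>" "y \<in> S"
  shows "clip n J c \<bullet> y \<le> \<delta>"
proof -
  define z where "z = vec n (\<lambda>j. if j \<in> J \<and> 0 < c $ j then y $ j else 0)"
  note y = down_closedD[OF assms(1,3)]
  have "z \<in> S" using y(2) by (intro y(3)) (auto simp: z_def)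
  moreover have "clip n J c \<bullet> y = c \<bullet> z"
    using y(1) by (auto simp: scalar_prod_lessThan[of _ n] z_def clip_def intro!: sum.cong)
  ultimately show ?thesis using assms(2) by simp
qed

lemma scalar_prod_le_clip:
  assumes "x \<in> carrier_vec n" "\<And>j. j < n \<Longrightarrow> 0 \<le> x $ j" "\<And>j. j < n \<Longrightarrow> j \<notin> J \<Longrightarrow> x $ j = 0"
  shows "c \<bullet> x \<le> clip n J c \<bullet> x"
  using assms by (auto simp: scalar_prod_lessThan[of _ n] clip_def mult_nonpos_nonneg intro!: sum_mono)

text \<open>Clipping with \<open>J = UNIV\<close> reduces every cut to one with nonnegative
  coefficients, which is monotone in the point.\<close>

lemma gomory_closure_down_closed:
  assumes "down_closed n P"
  shows "down_closed n (gomory_closure n P)"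
proof -
  have "y \<in> gomory_closure n P" if x: "x \<in> gomory_closure n P"
    and y: "y \<in> carrier_vec n" "\<forall>j<n. 0 \<le> y $ j \<and> y $ j \<le> x $ j" for x y
  proof -
    have xP: "x \<in> P" using x by (simp add: gomory_closure_def)
    have "c \<bullet> y \<le> of_int \<lfloor>\<delta>\<rfloor>" if c: "c \<in> int_vecs n" "\<forall>z\<in>P. c \<bullet> z \<le> \<delta>" for c \<delta>
    proof -
      have "c \<bullet> y \<le> clip n UNIV c \<bullet> y" using y by (intro scalar_prod_le_clip) auto
      also have "\<dots> \<le> clip n UNIV c \<bullet> x"
        using y down_closedD(1)[OF assms xP]
        by (auto simp: scalar_prod_lessThan[of _ n] clip_def intro!: sum_mono mult_left_mono)
      also have "\<dots> \<le> of_int \<lfloor>\<delta>\<rfloor>"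
        using x clip_int_vecs[OF c(1)] clip_valid[OF assms] c(2) by (auto simp: gomory_closure_def)
      finally show ?thesis .
    qed
    moreover have "y \<in> P" using down_closedD(3)[OF assms xP y(1)] y(2) by blast
    ultimately show ?thesis by (auto simp: gomory_closure_def)
  qed
  then show ?thesis
    using down_closedD[OF assms] gomory_closure_subset[of n P] unfolding down_closed_def by blast
qed

lemma iterated_gomory_closure_down_closed:
  "down_closed n P \<Longrightarrow> down_closed n (iterated_gomory_closure n t P)"
  by (induction t)
    (auto simp: iterated_gomory_closure_0 iterated_gomory_closure_Suc gomory_closure_down_closed)

text \<open>An integer that is at most \<delta> is at most its floor, so rounding never cuts off an
  integral point.\<close>

lemma int_vecs_in_gomory_closure:
  assumes "x \<in> P" "x \<in> int_vecs n"
  shows "x \<in> gomory_closure n P"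
proof -
  have "c \<bullet> x \<le> of_int \<lfloor>\<delta>\<rfloor>" if c: "c \<in> int_vecs n" "\<forall>z\<in>P. c \<bullet> z \<le> \<delta>" for c \<delta>
  proof -
    have "c \<bullet> x \<in> \<int>"
      using assms(2) c(1) by (auto simp: scalar_prod_lessThan[of _ n] int_vecs_def)
    then obtain i where "c \<bullet> x = of_int i" by (auto elim: Ints_cases)
    moreover have "c \<bullet> x \<le> \<delta>" using c(2) assms(1) by blast
    ultimately show ?thesis by (simp add: le_floor_iff)
  qed
  then show ?thesis using assms(1) by (auto simp: gomory_closure_def)
qed

lemma int_vecs_in_iterated_gomory_closure:
  "x \<in> P \<Longrightarrow> x \<in> int_vecs n \<Longrightarrow> x \<in> iterated_gomory_closure n t P"
  by (induction t)
    (auto simp: iterated_gomory_closure_0 iterated_gomory_closure_Suc int_vecs_in_gomory_closure)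

text \<open>After clipping to \<open>J\<close> there are two cases. A positive coefficient at
  \<open>j\<close> is at least 1, and the unit vector of \<open>j\<close> then forces
  \<open>\<delta> \<ge> 1\<close>, so the rounded bound is a natural number
  \<open>k \<ge> 1\<close>. If no positive coefficient remains, the clipped cut is 0 and the origin
  gives \<open>\<delta> \<ge> 0\<close>.\<close>

lemma down_closed_gomory_closureI:
  assumes S: "down_closed n S" and J: "\<And>j. j \<in> J \<Longrightarrow> j < n \<Longrightarrow> unit_vec n j \<in> S"
    and x: "x \<in> S" "\<And>j. j < n \<Longrightarrow> j \<notin> J \<Longrightarrow> x $ j = 0"
    and cut: "\<And>c \<delta> k. c \<in> int_vecs n \<Longrightarrow> (\<And>j. j < n \<Longrightarrow> 0 \<le> c $ j) \<Longrightarrow>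
      (\<And>j. j < n \<Longrightarrow> j \<notin> J \<Longrightarrow> c $ j = 0) \<Longrightarrow> (\<And>y. y \<in> S \<Longrightarrow> c \<bullet> y \<le> \<delta>) \<Longrightarrow>
      1 \<le> k \<Longrightarrow> \<delta> < real k + 1 \<Longrightarrow> real k \<le> \<delta> \<Longrightarrow> c \<bullet> x \<le> real k"
  shows "x \<in> gomory_closure n S"
proof -
  have "c \<bullet> x \<le> of_int \<lfloor>\<delta>\<rfloor>" if c: "c \<in> int_vecs n" "\<forall>z\<in>S. c \<bullet> z \<le> \<delta>" for c \<delta>
  proof -
    define c' where "c' = clip n J c"
    have valid: "c' \<bullet> y \<le> \<delta>" if "y \<in> S" for y
      unfolding c'_def using clip_valid[OF S _ that] c(2) by blast
    have le: "c \<bullet> x \<le> c' \<bullet> x"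
      unfolding c'_def using down_closedD[OF S x(1)] x(2) by (intro scalar_prod_le_clip) auto
    have xc: "x \<in> carrier_vec n" using down_closedD[OF S x(1)] by blast
    show ?thesis
    proof (cases "\<exists>j<n. j \<in> J \<and> 0 < c $ j")
      case True
      then obtain j where j: "j < n" "j \<in> J" "0 < c $ j" by blast
      have "c $ j \<in> \<int>" using c(1) j(1) by (auto simp: int_vecs_def)
      then have "1 \<le> c $ j" using j(3) by (auto elim!: Ints_cases)
      also have "c $ j = c \<bullet> unit_vec n j"
        using c(1) j(1) by (auto simp: int_vecs_def)
      also have "\<dots> \<le> \<delta>" using c(2) J[OF j(2,1)] by blast
      finally have "1 \<le> \<delta>" .
      then have k: "1 \<le> nat \<lfloor>\<delta>\<rfloor>" "real (nat \<lfloor>\<delta>\<rfloor>) = of_int \<lfloor>\<delta>\<rfloor>" by (auto simp: le_nat_iff le_floor_iff)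
      have "c' \<bullet> x \<le> real (nat \<lfloor>\<delta>\<rfloor>)"
      proof (rule cut)
        show "c' \<in> int_vecs n" unfolding c'_def by (rule clip_int_vecs[OF c(1)])
        show "\<delta> < real (nat \<lfloor>\<delta>\<rfloor>) + 1" "real (nat \<lfloor>\<delta>\<rfloor>) \<le> \<delta>" unfolding k(2) by linarith+
      qed (use valid k in \<open>auto simp: c'_def clip_def\<close>)
      then show ?thesis using le k(2) by linarith
    next
      case False
      then have "c' \<bullet> x = 0" by (auto simp: scalar_prod_lessThan[OF xc] c'_def clip_def intro!: sum.neutral)
      moreover have "c' \<bullet> 0\<^sub>v n = 0" by (simp add: c'_def clip_def)
      moreover have "0\<^sub>v n \<in> S" using down_closedD[OF S x(1)] by auto
      ultimately show ?thesis using valid[of "0\<^sub>v n"] le by (simp add: order_trans)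
    qed
  qed
  then show ?thesis using x(1) by (auto simp: gomory_closure_def)
qed

lemma unit_vec_int: "unit_vec n j \<in> int_vecs n"
  by (auto simp: int_vecs_def unit_vec_def)

text \<open>A round costs at most a factor 2 because \<open>\<delta> \<le> 2 * \<lfloor>\<delta>\<rfloor>\<close> for \<open>\<delta> \<ge> 1\<close>, and cuts with
  \<open>\<delta> < 1\<close> only involve coordinates that vanish at all integer points of \<open>P\<close>.\<close>

lemma half_power_in_iterated_gomory_closure:
  assumes P: "down_closed n P" and x: "x \<in> P" "\<And>j. j < n \<Longrightarrow> unit_vec n j \<notin> P \<Longrightarrow> x $ j = 0"
  shows "(1 / 2) ^ t \<cdot>\<^sub>v x \<in> iterated_gomory_closure n t P"
proof (induction t)
  case 0
  then show ?case using x(1) by (simp add: iterated_gomory_closure_0)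
next
  case (Suc t)
  define S where "S = iterated_gomory_closure n t P"
  define w where "w = (1 / 2) ^ t \<cdot>\<^sub>v x"
  have S: "down_closed n S" unfolding S_def by (rule iterated_gomory_closure_down_closed[OF P])
  have wS: "w \<in> S" using Suc by (simp add: S_def w_def)
  have xc: "x \<in> carrier_vec n" "\<And>j. j < n \<Longrightarrow> 0 \<le> x $ j" using down_closedD[OF P x(1)] by blast+
  have "(1 / 2) ^ Suc t \<cdot>\<^sub>v x \<in> gomory_closure n S"
  proof (rule down_closed_gomory_closureI[OF S, where J = "{j. unit_vec n j \<in> P}"])
    show "unit_vec n j \<in> S" if "j \<in> {j. unit_vec n j \<in> P}" for j
      using that unit_vec_int int_vecs_in_iterated_gomory_closure by (auto simp: S_def)
    show "(1 / 2) ^ Suc t \<cdot>\<^sub>v x \<in> S"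
      using xc by (intro down_closedD(3)[OF S wS]) (auto simp: w_def mult_right_mono)
    fix c :: "real vec" and \<delta> :: real and k :: nat
    assume c: "\<And>y. y \<in> S \<Longrightarrow> c \<bullet> y \<le> \<delta>" "1 \<le> k" "\<delta> < real k + 1"
    have "c \<bullet> ((1 / 2) ^ Suc t \<cdot>\<^sub>v x) = 1 / 2 * (c \<bullet> w)"
      using xc by (simp add: w_def scalar_prod_lessThan[of _ n] sum_distrib_left algebra_simps)
    also have "\<dots> \<le> 1 / 2 * \<delta>" using c(1)[OF wS] by simp
    also have "\<dots> \<le> real k" using c(2,3) by simp
    finally show "c \<bullet> ((1 / 2) ^ Suc t \<cdot>\<^sub>v x) \<le> real k" .
  qed (use x(2) xc in auto)
  then show ?case by (simp add: iterated_gomory_closure_Suc S_def)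
qed

subsection \<open>The branching formulation\<close>

text \<open>A node is the list of branchings made so far, the latest first: a row index together
  with the set of its large entries guessed to be 1. The root is the empty list.\<close>

type_synonym node = "(nat \<times> nat set) list"

text \<open>The threshold \<theta> separates large from small entries of a row, \<open>g\<close>
  caps the size of a guess and \<open>d\<close> is the depth of the tree. Their values are fixed in
  \<open>packing_relaxation\<close>.\<close>

locale packing_lift =
  fixes a :: "nat \<Rightarrow> nat \<Rightarrow> real" and m n :: nat and \<theta> :: real and g d :: nat
  assumes a_nonneg: "i < m \<Longrightarrow> j < n \<Longrightarrow> 0 \<le> a i j"
    and theta_pos: "0 < \<theta>"
begin

definition big :: "nat \<Rightarrow> nat set" where
  "big i = {j. j < n \<and> \<theta> < a i j}"

text \<open>A row leaves room for at most \<open>1 / \<theta>\<close> large entries set to 1, so for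
  \<open>g \<ge> 1 / \<theta>\<close> the cap loses no 0/1 point, while the number of guesses stays
  polynomial in \<open>n\<close>.\<close>

definition guesses :: "nat \<Rightarrow> nat set set" where
  "guesses i = {J. J \<subseteq> big i \<and> card J \<le> g}"

definition nodes :: "node set" where
  "nodes = {s. set s \<subseteq> (SIGMA i:{..<m}. guesses i) \<and> length s \<le> d}"

text \<open>These are the coordinates whose unit vector lies in the packing polyhedron; all others
  vanish at every integer point of it.\<close>

definition fitting :: "nat set" where
  "fitting = {j. j < n \<and> (\<forall>i<m. a i j \<le> 1)}"

text \<open>Node \<open>s\<close> carries a point \<open>(y (s, j))\<^bsub>j<n\<^esub>\<close> of the polyhedron scaled by the weight \<open>y (s, n)\<close>.\<close>

definition lift_solution :: "(node \<times> nat \<Rightarrow> real) \<Rightarrow> bool" where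
  "lift_solution y \<longleftrightarrow>
    (\<forall>s\<in>nodes. 0 \<le> y (s, n) \<and>
       (\<forall>j<n. 0 \<le> y (s, j) \<and> y (s, j) \<le> (if j \<in> fitting then 1 else 0) * y (s, n)) \<and>
       (\<forall>i<m. (\<Sum>j<n. a i j * y (s, j)) \<le> y (s, n)) \<and>
       (length s < d \<longrightarrow> (\<forall>i<m. \<forall>j\<le>n. (\<Sum>J\<in>guesses i. y ((i, J) # s, j)) = y (s, j)))) \<and>
    (\<forall>s i J. (i, J) # s \<in> nodes \<longrightarrow>
       (\<forall>j\<in>big i. y ((i, J) # s, j) = (if j \<in> J then y ((i, J) # s, n) else 0))) \<and>
    y ([], n) = 1"

text \<open>After division by the weight these coordinates equal 1. At a node of weight 0 of a
  solution, every coordinate counts as tight.\<close>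

definition tight :: "(node \<times> nat \<Rightarrow> real) \<Rightarrow> node \<Rightarrow> nat set" where
  "tight y s = {j. j < n \<and> y (s, j) = y (s, n)}"

lemma finite_big: "finite (big i)" "big i \<subseteq> {..<n}"
  by (auto simp: big_def)

lemma finite_guesses: "finite (guesses i)"
  unfolding guesses_def by (rule finite_subset[of _ "Pow (big i)"]) (auto simp: finite_big)

lemma Cons_in_nodes: "s \<in> nodes \<Longrightarrow> length s < d \<Longrightarrow> i < m \<Longrightarrow> J \<in> guesses i \<Longrightarrow> (i, J) # s \<in> nodes"
  by (auto simp: nodes_def)

lemma lift_solutionD:
  assumes "lift_solution y" "s \<in> nodes"
  shows "0 \<le> y (s, n)" "\<And>j. j < n \<Longrightarrow> 0 \<le> y (s, j)" "\<And>j. j < n \<Longrightarrow> y (s, j) \<le> y (s, n)"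
    "\<And>j. j < n \<Longrightarrow> j \<notin> fitting \<Longrightarrow> y (s, j) = 0"
    "\<And>i. i < m \<Longrightarrow> (\<Sum>j<n. a i j * y (s, j)) \<le> y (s, n)"
    "\<And>i j. length s < d \<Longrightarrow> i < m \<Longrightarrow> j \<le> n \<Longrightarrow> (\<Sum>J\<in>guesses i. y ((i, J) # s, j)) = y (s, j)"
proof -
  have *: "0 \<le> y (s, n)"
    "\<forall>j<n. 0 \<le> y (s, j) \<and> y (s, j) \<le> (if j \<in> fitting then 1 else 0) * y (s, n)"
    "\<forall>i<m. (\<Sum>j<n. a i j * y (s, j)) \<le> y (s, n)"
    "length s < d \<longrightarrow> (\<forall>i<m. \<forall>j\<le>n. (\<Sum>J\<in>guesses i. y ((i, J) # s, j)) = y (s, j))"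
    using assms unfolding lift_solution_def by blast+
  show "0 \<le> y (s, n)" by (rule *(1))
  show "0 \<le> y (s, j)" if "j < n" for j using *(2) that by blast
  show "y (s, j) \<le> y (s, n)" if "j < n" for j
    using *(1) *(2)[rule_format, OF that] by (cases "j \<in> fitting") auto
  show "y (s, j) = 0" if "j < n" "j \<notin> fitting" for j
    using *(2)[rule_format, OF that(1)] that(2) by auto
  show "(\<Sum>j<n. a i j * y (s, j)) \<le> y (s, n)" if "i < m" for i using *(3) that by blast
  show "(\<Sum>J\<in>guesses i. y ((i, J) # s, j)) = y (s, j)" if "length s < d" "i < m" "j \<le> n" for i j
    using *(4) that by blast
qed

lemma lift_solution_child:
  "lift_solution y \<Longrightarrow> (i, J) # s \<in> nodes \<Longrightarrow> j \<in> big i \<Longrightarrow>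
    y ((i, J) # s, j) = (if j \<in> J then y ((i, J) # s, n) else 0)"
  unfolding lift_solution_def by blast

lemma tight_subset: "tight y s \<subseteq> {..<n}"
  by (auto simp: tight_def)

text \<open>The gaps between weight and coordinate are nonnegative at the children and add up to the
  gap at \<open>s\<close>, which is 0.\<close>

lemma tight_child_subset:
  assumes y: "lift_solution y" and s: "s \<in> nodes" "length s < d" and i: "i < m" and J: "J \<in> guesses i"
  shows "tight y s \<subseteq> tight y ((i, J) # s)"
proof
  fix j assume "j \<in> tight y s"
  then have j: "j < n" "y (s, j) = y (s, n)" by (auto simp: tight_def)
  have "(\<Sum>J\<in>guesses i. y ((i, J) # s, n) - y ((i, J) # s, j)) = 0"
    using lift_solutionD(6)[OF y s(1,2) i] j by (simp add: sum_subtractf)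
  moreover have "0 \<le> y ((i, J) # s, n) - y ((i, J) # s, j)" if "J \<in> guesses i" for J
    using lift_solutionD(3)[OF y Cons_in_nodes[OF s i that] j(1)] by simp
  ultimately have "y ((i, J) # s, n) - y ((i, J) # s, j) = 0"
    using J sum_nonneg_eq_0_iff[OF finite_guesses, of i] by (metis (no_types, lifting))
  then show "j \<in> tight y ((i, J) # s)" using j(1) by (simp add: tight_def)
qed

text \<open>If no row had enough mass on its big entries, then the part of the point outside \<open>I\<close>
  could be scaled up to a point of the packing polyhedron of value \<open>2 * M\<close>.\<close>

lemma heavy_row_exists:
  assumes c: "\<And>j. j < n \<Longrightarrow> c j = 0 \<or> 1 \<le> c j"
    and bound: "\<And>z. (\<And>j. j < n \<Longrightarrow> 0 \<le> z j) \<Longrightarrow> (\<And>j. j < n \<Longrightarrow> j \<notin> fitting \<Longrightarrow> z j = 0) \<Longrightarrow>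
      (\<And>i. i < m \<Longrightarrow> (\<Sum>j<n. a i j * z j) \<le> 1) \<Longrightarrow> (\<Sum>j<n. c j * z j) \<le> M"
    and M: "0 < M" "\<theta> = 1 / (4 * M)"
    and x: "\<And>j. j < n \<Longrightarrow> 0 \<le> x j" "\<And>j. j < n \<Longrightarrow> j \<notin> fitting \<Longrightarrow> x j = 0"
    and H: "0 < (\<Sum>j\<in>{..<n} - I. c j * x j)"
  shows "\<exists>i<m. \<theta> * (\<Sum>j\<in>{..<n} - I. c j * x j) \<le> (\<Sum>j\<in>big i - I. c j * x j)"
proof (rule ccontr)
  define H where "H = (\<Sum>j\<in>{..<n} - I. c j * x j)"
  \<comment> \<open>This scaling gives the part outside \<open>I\<close> the value
    \<open>2 * M\<close>, twice what \<open>bound\<close> permits.\<close>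
  define \<beta> where "\<beta> = 2 * M / H"
  \<comment> \<open>Coordinates with \<open>c j = 0\<close> are removed because the estimate of
    \<open>x j\<close> by \<open>c j * x j\<close> needs \<open>c j \<ge> 1\<close>.\<close>
  define z where "z j = (if j \<in> I \<or> c j = 0 then 0 else \<beta> * x j)" for j
  assume "\<not> ?thesis"
  then have small: "(\<Sum>j\<in>big i - I. c j * x j) < \<theta> * H" if "i < m" for i
    using that by (force simp: H_def)
  have H0: "0 < H" using H by (simp add: H_def)
  have \<beta>0: "0 < \<beta>" using H0 M by (simp add: \<beta>_def)
  have c0: "0 \<le> c j" if "j < n" for j using c[OF that] by auto
  have "(\<Sum>j<n. c j * z j) \<le> M"
  proof (rule bound)
    show "0 \<le> z j" if "j < n" for j using that x(1) \<beta>0 by (auto simp: z_def)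
    show "z j = 0" if "j < n" "j \<notin> fitting" for j using that x(2) by (auto simp: z_def)
    fix i assume i: "i < m"
    have "a i j * z j \<le> (if j \<in> I then 0
        else \<beta> * (if j \<in> big i then c j * x j else 0) + \<beta> * (\<theta> * (c j * x j)))" if j: "j < n" for j
    proof (cases "j \<in> I \<or> c j = 0 \<or> j \<notin> fitting")
      case True
      then show ?thesis using j x theta_pos \<beta>0 c0 by (auto simp: z_def)
    next
      case False
      then have c1: "1 \<le> c j" using c[OF j] by auto
      have a1: "a i j \<le> 1" using False i by (auto simp: fitting_def)
      have xc: "x j \<le> c j * x j" using c1 x(1)[OF j] mult_right_mono[of 1 "c j" "x j"] by simp
      \<comment> \<open>A large entry is at most 1 because \<open>j\<close> is fitting, a small one
        is at most \<theta>; in both cases \<open>x j\<close> is then replaced by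
        \<open>c j * x j\<close>.\<close>
      have "a i j * x j \<le> (if j \<in> big i then c j * x j else 0) + \<theta> * (c j * x j)"
      proof (cases "j \<in> big i")
        case True
        have "a i j * x j \<le> x j" using a1 x(1)[OF j] mult_right_mono[of "a i j" 1 "x j"] by simp
        moreover have "0 \<le> \<theta> * (c j * x j)" using theta_pos c0[OF j] x(1)[OF j] by simp
        ultimately show ?thesis using xc True by simp
      next
        case False
        then have "a i j * x j \<le> \<theta> * x j" using j x(1)[OF j] by (auto simp: big_def mult_right_mono)
        also have "\<dots> \<le> \<theta> * (c j * x j)" using xc theta_pos by simp
        finally show ?thesis using False by simp
      qed
      then have "\<beta> * (a i j * x j) \<le> \<beta> * ((if j \<in> big i then c j * x j else 0) + \<theta> * (c j * x j))"
        using \<beta>0 by simp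
      moreover have "j \<notin> I" "z j = \<beta> * x j" using False by (auto simp: z_def)
      ultimately show ?thesis by (simp add: distrib_left algebra_simps)
    qed
    then have "(\<Sum>j<n. a i j * z j) \<le> (\<Sum>j<n. if j \<in> I then 0
        else \<beta> * (if j \<in> big i then c j * x j else 0) + \<beta> * (\<theta> * (c j * x j)))"
      by (intro sum_mono) auto
    also have "\<dots> = (\<Sum>j\<in>{..<n} - I. \<beta> * (if j \<in> big i then c j * x j else 0) + \<beta> * (\<theta> * (c j * x j)))"
      by (rule sum.mono_neutral_cong_right) auto
    also have "\<dots> = \<beta> * (\<Sum>j\<in>{..<n} - I. if j \<in> big i then c j * x j else 0) + \<beta> * (\<theta> * H)"
      by (simp add: sum.distrib H_def sum_distrib_left)
    also have "(\<Sum>j\<in>{..<n} - I. if j \<in> big i then c j * x j else 0) = (\<Sum>j\<in>big i - I. c j * x j)"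
      using finite_big(2)[of i] by (intro sum.mono_neutral_cong_right) auto
    also have "\<beta> * \<dots> + \<beta> * (\<theta> * H) \<le> \<beta> * (\<theta> * H) + \<beta> * (\<theta> * H)"
      using \<beta>0 by (intro add_right_mono mult_left_mono less_imp_le[OF small[OF i]]) simp
    \<comment> \<open>The choice \<open>\<theta> = 1 / (4 * M)\<close> makes each of the two
      summands equal to 1/2.\<close>
    also have "\<dots> = 1" using H0 M by (simp add: \<beta>_def field_simps)
    finally show "(\<Sum>j<n. a i j * z j) \<le> 1" .
  qed
  moreover have "(\<Sum>j<n. c j * z j) = (\<Sum>j\<in>{..<n} - I. \<beta> * (c j * x j))"
    by (rule sum.mono_neutral_cong_right) (auto simp: z_def)
  moreover have "\<dots> = \<beta> * H" by (simp add: H_def sum_distrib_left)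
  moreover have "\<beta> * H = 2 * M" using H0 by (simp add: \<beta>_def)
  ultimately show False using M by simp
qed

end

text \<open>Index \<open>p\<close> stands for the children where a new item of the support becomes
  tight (error \<open>e\<close>), index \<open>q\<close> for the others (error
  \<open>2 * e\<close>). If \<open>W\<close> exceeds \<open>\<mu> * (k + e)\<close>, the
  \<open>p\<close>-children must carry the \<theta>-fraction of \<open>H\<close> missing in the
  others. This forces their weight above \<open>\<theta> * \<mu>\<close>, so at most the weight
  \<open>(1 - \<theta>) * \<mu>\<close> pays the second \<open>e\<close>.\<close>

lemma branching_bound:
  fixes \<mu> \<mu>p \<mu>q W Wp Wq H q k e \<theta> :: real
  assumes "\<mu> = \<mu>p + \<mu>q" "0 < \<mu>" "0 \<le> \<mu>q" "W = Wp + Wq" "q \<le> k" "0 < e" "0 < \<theta>" "\<theta> \<le> 1"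
    and p: "Wp \<le> \<mu>p * (k + e)" and q: "Wq \<le> \<mu>q * (k + 2 * e)"
    and H: "W - q * \<mu> = H" "Wq - q * \<mu>q \<le> (1 - \<theta>) * H"
  shows "W \<le> \<mu> * (k + (2 - \<theta>) * e)"
proof (cases "W \<le> \<mu> * (k + e)")
  case True
  have "\<mu> * (k + e) \<le> \<mu> * (k + (2 - \<theta>) * e)"
    using assms by (intro mult_left_mono) (auto simp: algebra_simps mult_left_le_one_le)
  then show ?thesis using True by linarith
next
  case False
  \<comment> \<open>The excess over \<open>q\<close> per unit of weight that the bound
    \<open>p\<close> allows.\<close>
  define r where "r = k - q + e"
  have r: "0 < r" using assms by (simp add: r_def)
  have "\<mu> * r < H" using False H by (simp add: r_def algebra_simps)
  then have "\<theta> * (\<mu> * r) < \<theta> * H" using assms by simp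
  \<comment> \<open>\<open>H\<close> splits into the excesses of the two groups of children, and
    that of the \<open>q\<close>-children is at most \<open>(1 - \<theta>) * H\<close>.\<close>
  also have "\<theta> * H \<le> Wp - q * \<mu>p" using H assms by (simp add: algebra_simps)
  also have "\<dots> \<le> \<mu>p * r" using p by (simp add: r_def algebra_simps)
  finally have "(\<theta> * \<mu>) * r < \<mu>p * r" by (simp add: mult.assoc)
  then have "\<theta> * \<mu> < \<mu>p" using r by simp
  then have "\<mu>q * e \<le> ((1 - \<theta>) * \<mu>) * e" using assms by (intro mult_right_mono) (auto simp: algebra_simps)
  then show ?thesis using p q assms by (simp add: algebra_simps)
qed

section \<open>The value of a cut at the nodes of the tree\<close>

context packing_lift
begin

text \<open>The indicator vector of the tight set, scaled by the weight, lies below the point at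
  \<open>s\<close>. So the tight set satisfies every row and is a feasible 0/1 point, to which
  \<open>feas\<close> applies.\<close>

lemma tight_feasible_bound:
  assumes y: "lift_solution y" and s: "s \<in> nodes" "0 < y (s, n)"
    and feas: "\<And>I. I \<subseteq> {..<n} \<Longrightarrow> (\<And>i. i < m \<Longrightarrow> (\<Sum>j\<in>I. a i j) \<le> 1) \<Longrightarrow> (\<Sum>j\<in>I. c j) \<le> k"
  shows "(\<Sum>j\<in>tight y s. c j) \<le> k"
proof (rule feas[OF tight_subset])
  fix i assume i: "i < m"
  have "(\<Sum>j\<in>tight y s. a i j) * y (s, n) = (\<Sum>j\<in>tight y s. a i j * y (s, j))"
    unfolding sum_distrib_right by (rule sum.cong) (auto simp: tight_def)
  also have "\<dots> \<le> (\<Sum>j<n. a i j * y (s, j))"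
    using a_nonneg[OF i] lift_solutionD(2)[OF y s(1)] tight_subset by (intro sum_mono2) auto
  also have "\<dots> \<le> y (s, n)" by (rule lift_solutionD(5)[OF y s(1) i])
  finally show "(\<Sum>j\<in>tight y s. a i j) \<le> 1" using s(2) by simp
qed

text \<open>Induction over the remaining depth. Branching on a heavy row either makes a further item of
  the support of \<open>c\<close> tight, which halves the error term, or it discards a \<open>\<theta>\<close>-fraction of the mass
  that is not tight yet.\<close>

lemma node_value_bound:
  assumes y: "lift_solution y"
    and c: "\<And>j. j < n \<Longrightarrow> c j = 0 \<or> 1 \<le> c j"
    and feas: "\<And>I. I \<subseteq> {..<n} \<Longrightarrow> (\<And>i. i < m \<Longrightarrow> (\<Sum>j\<in>I. a i j) \<le> 1) \<Longrightarrow> (\<Sum>j\<in>I. c j) \<le> k"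
    and bound: "\<And>z. (\<And>j. j < n \<Longrightarrow> 0 \<le> z j) \<Longrightarrow> (\<And>j. j < n \<Longrightarrow> j \<notin> fitting \<Longrightarrow> z j = 0) \<Longrightarrow>
      (\<And>i. i < m \<Longrightarrow> (\<Sum>j<n. a i j * z j) \<le> 1) \<Longrightarrow> (\<Sum>j<n. c j * z j) \<le> M"
    and M: "1 \<le> M" "\<theta> = 1 / (4 * M)"
    and s: "s \<in> nodes" "length s + D = d"
  shows "(\<Sum>j<n. c j * y (s, j)) \<le>
    y (s, n) * (k + M * 2 powr (k - (\<Sum>j\<in>tight y s. c j)) * (1 - \<theta> / 2) ^ D)"
  using s
proof (induction D arbitrary: s)
  case (0 s)
  note D = lift_solutionD[OF y 0(1)]
  define \<mu> where "\<mu> = y (s, n)"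
  have k: "0 \<le> k" using feas[of "{}"] by simp
  show ?case
  proof (cases "\<mu> = 0")
    case True
    then have "y (s, j) = 0" if "j < n" for j using D(2,3)[OF that] by (simp add: \<mu>_def)
    then show ?thesis using True by (simp add: \<mu>_def)
  next
    case False
    then have \<mu>: "0 < \<mu>" using D(1) by (simp add: \<mu>_def)
    have "(\<Sum>j\<in>tight y s. c j) \<le> k" by (rule tight_feasible_bound[OF y 0(1) _ feas]) (use \<mu> in \<open>auto simp: \<mu>_def\<close>)
    \<comment> \<open>At a leaf the exponent is nonnegative, so the error term is at least
      \<open>M\<close>, and the a priori bound \<open>M\<close> on the value is enough.\<close>
    then have "1 \<le> 2 powr (k - (\<Sum>j\<in>tight y s. c j))" by (simp add: ge_one_powr_ge_zero)
    then have "M \<le> M * 2 powr (k - (\<Sum>j\<in>tight y s. c j))" using M by simp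
    moreover have "(\<Sum>j<n. c j * (y (s, j) / \<mu>)) \<le> M"
      using \<mu> D by (intro bound) (auto simp: \<mu>_def simp flip: sum_divide_distrib)
    then have "(\<Sum>j<n. c j * y (s, j)) \<le> \<mu> * M"
      using \<mu> by (simp add: field_simps flip: sum_divide_distrib)
    moreover note k
    ultimately show ?thesis using \<mu> by (simp flip: \<mu>_def) (smt (verit) mult_left_mono)
  qed
next
  case (Suc D s)
  have len: "length s < d" using Suc.prems by simp
  note D = lift_solutionD[OF y Suc.prems(1)]
  define \<mu> where "\<mu> = y (s, n)"
  define I where "I = tight y s"
  define q where "q = (\<Sum>j\<in>I. c j)"
  define W where "W = (\<Sum>j<n. c j * y (s, j))"
  define H where "H = (\<Sum>j\<in>{..<n} - I. c j * y (s, j))"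
  \<comment> \<open>The error at remaining depth \<open>D\<close> once the tight value has grown by
    1. Without such growth the error is \<open>2 * e\<close>, and the target for \<open>s\<close> is
    \<open>2 * (1 - \<theta> / 2) * e = (2 - \<theta>) * e\<close>.\<close>
  define e where "e = M * 2 powr (k - q - 1) * (1 - \<theta> / 2) ^ D"
  have I: "I \<subseteq> {..<n}" "finite I" unfolding I_def using tight_subset finite_subset by blast+
  have c0: "0 \<le> c j" if "j < n" for j using c[OF that] by auto
  have \<theta>: "\<theta> \<le> 1" using M by simp
  have e0: "0 < e" using M \<theta> by (simp add: e_def)
  have split: "(\<Sum>j<n. f j) = (\<Sum>j\<in>I. f j) + (\<Sum>j\<in>{..<n} - I. f j)" for f :: "nat \<Rightarrow> real"
    using sum.subset_diff[OF I(1), of f] by simp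
  have qI: "(\<Sum>j\<in>I. c j * y (s, j)) = q * \<mu>"
    unfolding q_def sum_distrib_right by (rule sum.cong) (auto simp: I_def tight_def \<mu>_def)
  have WH: "W - q * \<mu> = H" by (simp add: W_def H_def split qI)
  have e2: "M * 2 powr (k - q) * (1 - \<theta> / 2) ^ Suc D = (2 - \<theta>) * e"
    by (simp add: e_def powr_diff powr_add field_simps)
  have "W \<le> \<mu> * (k + (2 - \<theta>) * e)"
  proof (cases "\<mu> = 0")
    case True
    then have "y (s, j) = 0" if "j < n" for j using D(2,3)[OF that] by (simp add: \<mu>_def)
    then show ?thesis using True by (simp add: W_def)
  next
    case False
    then have \<mu>: "0 < \<mu>" using D(1) by (simp add: \<mu>_def)
    have qk: "q \<le> k"
      unfolding q_def I_def
      by (rule tight_feasible_bound[OF y Suc.prems(1) _ feas]) (use \<mu> in \<open>auto simp: \<mu>_def\<close>)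
    have H0: "0 \<le> H" unfolding H_def using c0 D(2) by (intro sum_nonneg) auto
    show ?thesis
    proof (cases "H = 0")
      case True
      then have "W \<le> \<mu> * k" using WH qk \<mu> by simp
      also have "\<dots> \<le> \<mu> * (k + (2 - \<theta>) * e)" using \<mu> e0 \<theta> by (intro mult_left_mono) auto
      finally show ?thesis .
    next
      case False
      then have "0 < H" using H0 by simp
      then have "\<exists>i<m. \<theta> * H \<le> (\<Sum>j\<in>big i - I. c j * y (s, j))"
        unfolding H_def using M D(2,4) by (intro heavy_row_exists[where M = M] c bound) auto
      then obtain i where i: "i < m" "\<theta> * H \<le> (\<Sum>j\<in>big i - I. c j * y (s, j))" by blast
      define G where "G = guesses i"
      define w where "w J = (i, J) # s" for J
      define V where "V J = (\<Sum>j<n. c j * y (w J, j))" for J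
      \<comment> \<open>The guesses that set a new item of the support of \<open>c\<close> to 1. Its
        coefficient is at least 1, so the tight value grows by at least 1.\<close>
      define Gp where "Gp = {J \<in> G. \<exists>j\<in>J. j \<notin> I \<and> c j \<noteq> 0}"
      define Gq where "Gq = G - Gp"
      have fin: "finite G" "finite Gp" "finite Gq" by (auto simp: G_def Gp_def Gq_def finite_guesses)
      have parts: "(\<Sum>J\<in>G. f J) = (\<Sum>J\<in>Gp. f J) + (\<Sum>J\<in>Gq. f J)" for f :: "nat set \<Rightarrow> real"
        using sum.subset_diff[of Gp G f] fin by (simp add: Gq_def Gp_def)
      have child: "(\<Sum>J\<in>G. y (w J, j)) = y (s, j)" if "j \<le> n" for j
        unfolding G_def w_def by (rule D(6)[OF len i(1) that])
      have wn: "w J \<in> nodes" if "J \<in> G" for J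
        using Cons_in_nodes[OF Suc.prems(1) len i(1)] that by (simp add: w_def G_def)
      have tI: "I \<subseteq> tight y (w J)" if "J \<in> G" for J
        using tight_child_subset[OF y Suc.prems(1) len i(1)] that by (simp add: w_def G_def I_def)
      have IH: "V J \<le> y (w J, n) * (k + M * 2 powr (k - r) * (1 - \<theta> / 2) ^ D)"
        if J: "J \<in> G" and r: "r \<le> (\<Sum>j\<in>tight y (w J). c j)" for J r
      proof -
        have "V J \<le> y (w J, n) * (k + M * 2 powr (k - (\<Sum>j\<in>tight y (w J). c j)) * (1 - \<theta> / 2) ^ D)"
          unfolding V_def using wn[OF J] Suc.prems(2) by (intro Suc.IH) (auto simp: w_def)
        also have "\<dots> \<le> y (w J, n) * (k + M * 2 powr (k - r) * (1 - \<theta> / 2) ^ D)"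
          using r M \<theta> lift_solutionD(1)[OF y wn[OF J]]
          by (intro mult_left_mono add_left_mono mult_right_mono) auto
        finally show ?thesis .
      qed
      have qle: "q \<le> (\<Sum>j\<in>tight y (w J). c j)" if "J \<in> G" for J
        unfolding q_def using tI[OF that] tight_subset[of y "w J"] c0 finite_subset[OF tight_subset]
        by (intro sum_mono2) auto
      have qp: "q + 1 \<le> (\<Sum>j\<in>tight y (w J). c j)" if JG: "J \<in> Gp" for J
      proof -
        obtain j where j: "j \<in> J" "j \<notin> I" "c j \<noteq> 0" and J: "J \<in> G" using JG by (auto simp: Gp_def)
        have jb: "j \<in> big i" using j(1) J by (auto simp: G_def guesses_def)
        then have jn: "j < n" by (auto simp: big_def)
        have "y (w J, j) = y (w J, n)"
          using lift_solution_child[OF y _ jb, of J s] wn[OF J] j(1) by (simp add: w_def)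
        then have "j \<in> tight y (w J)" using jn by (simp add: tight_def)
        then have "(\<Sum>j\<in>insert j I. c j) \<le> (\<Sum>j\<in>tight y (w J). c j)"
          using tI[OF J] tight_subset[of y "w J"] c0 finite_subset[OF tight_subset]
          by (intro sum_mono2) auto
        moreover have "1 \<le> c j" using c[OF jn] j(3) by simp
        ultimately show ?thesis using I(2) j(2) by (simp add: q_def)
      qed
      have p: "(\<Sum>J\<in>Gp. V J) \<le> (\<Sum>J\<in>Gp. y (w J, n)) * (k + e)"
        unfolding sum_distrib_right
      proof (rule sum_mono)
        fix J assume J: "J \<in> Gp"
        show "V J \<le> y (w J, n) * (k + e)"
          using IH[OF _ qp[OF J]] J by (simp add: Gp_def e_def diff_diff_eq)
      qed
      have qq: "(\<Sum>J\<in>Gq. V J) \<le> (\<Sum>J\<in>Gq. y (w J, n)) * (k + 2 * e)"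
        unfolding sum_distrib_right
      proof (rule sum_mono)
        fix J assume "J \<in> Gq"
        then have J: "J \<in> G" by (simp add: Gq_def)
        have "M * 2 powr (k - q) * (1 - \<theta> / 2) ^ D = 2 * e" by (simp add: e_def powr_diff)
        then show "V J \<le> y (w J, n) * (k + 2 * e)" using IH[OF J qle[OF J]] by simp
      qed
      \<comment> \<open>In a child from \<open>Gq\<close>, a large item outside \<open>I\<close>
        contributes nothing: if guessed, its coefficient is 0; otherwise its coordinate is set to
        0.\<close>
      have rest: "V J - q * y (w J, n) \<le> (\<Sum>j\<in>{..<n} - I - big i. c j * y (w J, j))" if JG: "J \<in> Gq" for J
      proof -
        have J: "J \<in> G" using JG by (simp add: Gq_def)
        have "(\<Sum>j\<in>I. c j * y (w J, j)) = q * y (w J, n)"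
          unfolding q_def sum_distrib_right using tI[OF J] by (intro sum.cong) (auto simp: tight_def)
        then have "V J - q * y (w J, n) = (\<Sum>j\<in>{..<n} - I. c j * y (w J, j))"
          by (simp add: V_def split)
        also have "\<dots> = (\<Sum>j\<in>{..<n} - I - big i. c j * y (w J, j))"
        proof (rule sum.mono_neutral_right)
          show "\<forall>j\<in>{..<n} - I - ({..<n} - I - big i). c j * y (w J, j) = 0"
          proof
            fix j assume j: "j \<in> {..<n} - I - ({..<n} - I - big i)"
            show "c j * y (w J, j) = 0"
            proof (cases "j \<in> J")
              case True
              then show ?thesis using j JG J by (auto simp: Gq_def Gp_def)
            next
              case False
              have "j \<in> big i" using j by blast
              then show ?thesis
                using lift_solution_child[OF y, of i J s j] wn[OF J] False by (simp add: w_def)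
            qed
          qed
        qed auto
        finally show ?thesis by simp
      qed
      have "(\<Sum>J\<in>Gq. V J) - q * (\<Sum>J\<in>Gq. y (w J, n)) = (\<Sum>J\<in>Gq. V J - q * y (w J, n))"
        by (simp add: sum_subtractf sum_distrib_left)
      also have "\<dots> \<le> (\<Sum>J\<in>Gq. \<Sum>j\<in>{..<n} - I - big i. c j * y (w J, j))"
        by (intro sum_mono rest)
      \<comment> \<open>Adding the nonnegative terms of \<open>Gp\<close> lets the children be
        summed back to the point at \<open>s\<close>.\<close>
      also have "\<dots> \<le> (\<Sum>J\<in>G. \<Sum>j\<in>{..<n} - I - big i. c j * y (w J, j))"
        using fin c0 lift_solutionD(2)[OF y wn] by (intro sum_mono2 sum_nonneg mult_nonneg_nonneg) (auto simp: Gq_def)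
      also have "\<dots> = (\<Sum>j\<in>{..<n} - I - big i. c j * (\<Sum>J\<in>G. y (w J, j)))"
        unfolding sum_distrib_left by (rule sum.swap)
      also have "\<dots> = (\<Sum>j\<in>{..<n} - I - big i. c j * y (s, j))"
        by (intro sum.cong) (auto simp: child)
      also have "\<dots> = H - (\<Sum>j\<in>big i - I. c j * y (s, j))"
      proof -
        have "{..<n} - I - (big i - I) = {..<n} - I - big i" "big i - I \<subseteq> {..<n} - I"
          using finite_big(2)[of i] by blast+
        then show ?thesis
          using sum.subset_diff[of "big i - I" "{..<n} - I" "\<lambda>j. c j * y (s, j)"]
          by (simp add: H_def)
      qed
      also have "\<dots> \<le> (1 - \<theta>) * H" using i(2) by (simp add: algebra_simps)
      finally have rq: "(\<Sum>J\<in>Gq. V J) - q * (\<Sum>J\<in>Gq. y (w J, n)) \<le> (1 - \<theta>) * H" .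
      have \<mu>s: "\<mu> = (\<Sum>J\<in>Gp. y (w J, n)) + (\<Sum>J\<in>Gq. y (w J, n))"
        using child[of n] parts[of "\<lambda>J. y (w J, n)"] by (simp add: \<mu>_def)
      have "(\<Sum>J\<in>G. V J) = (\<Sum>j<n. c j * (\<Sum>J\<in>G. y (w J, j)))"
        unfolding V_def sum_distrib_left by (rule sum.swap)
      also have "\<dots> = W" unfolding W_def by (intro sum.cong) (auto simp: child)
      finally have Ws: "W = (\<Sum>J\<in>Gp. V J) + (\<Sum>J\<in>Gq. V J)" by (simp add: parts)
      have "0 \<le> (\<Sum>J\<in>Gq. y (w J, n))"
        using lift_solutionD(1)[OF y wn] by (intro sum_nonneg) (auto simp: Gq_def)
      from branching_bound[OF \<mu>s \<mu> this Ws qk e0 theta_pos \<theta> p qq WH rq] show ?thesis .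
    qed
  qed
  then show ?case unfolding W_def \<mu>_def q_def I_def e2[unfolded q_def I_def] .
qed

end

section \<open>Size of the tree and of its constraint system\<close>

lemma card_bounded_subsets_le: "card {J. J \<subseteq> {..<n} \<and> card J \<le> g} \<le> (n + 1) ^ g"
proof -
  define X where "X = {xs. set xs \<subseteq> {..n} \<and> length xs = g}"
  have X: "finite X" "card X = (n + 1) ^ g"
    unfolding X_def by (simp_all add: finite_lists_length_eq card_lists_length_eq)
  have "{J. J \<subseteq> {..<n} \<and> card J \<le> g} \<subseteq> (\<lambda>xs. set xs \<inter> {..<n}) ` X"
  proof
    fix J assume "J \<in> {J. J \<subseteq> {..<n} \<and> card J \<le> g}"
    then have J: "J \<subseteq> {..<n}" "card J \<le> g" by auto
    then have fJ: "finite J" using finite_subset by blast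
    \<comment> \<open>The list is padded to length \<open>g\<close> with \<open>n\<close>, which
      lies outside the ground set and is removed again by the intersection.\<close>
    define xs where "xs = sorted_list_of_set J @ replicate (g - card J) n"
    have "xs \<in> X" using J fJ by (auto simp: X_def xs_def)
    moreover have "set xs \<inter> {..<n} = J" using J fJ by (auto simp: xs_def)
    ultimately show "J \<in> (\<lambda>xs. set xs \<inter> {..<n}) ` X" by blast
  qed
  then show ?thesis using surj_card_le[OF X(1)] X(2) by metis
qed

lemma sum_power_le: "(\<Sum>i\<le>d. k ^ i) \<le> (k + 1 :: nat) ^ d"
proof (induction d)
  case (Suc d)
  have "k ^ d \<le> (k + 1) ^ d" by (rule power_mono) auto
  then have "k ^ Suc d \<le> k * (k + 1) ^ d" by simp
  from add_mono[OF Suc this] show ?case by simp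
qed simp

context packing_lift
begin

lemma guesses_subset: "guesses i \<subseteq> {J. J \<subseteq> {..<n} \<and> card J \<le> g}"
  using finite_big(2) by (auto simp: guesses_def)

lemma finite_nodes: "finite nodes"
  unfolding nodes_def by (intro finite_lists_length_le finite_SigmaI finite_guesses) auto

lemma card_nodes_le: "card nodes \<le> (m * (n + 1) ^ g + 1) ^ d"
proof -
  define S where "S = (SIGMA i:{..<m}. guesses i)"
  have S: "finite S" unfolding S_def by (intro finite_SigmaI finite_guesses) auto
  have "card S = (\<Sum>i<m. card (guesses i))"
    unfolding S_def by (rule card_SigmaI) (auto simp: finite_guesses)
  also have "\<dots> \<le> (\<Sum>i<m. (n + 1) ^ g)"
  proof (rule sum_mono)
    fix i
    have "finite {J. J \<subseteq> {..<n} \<and> card J \<le> g}" by (rule finite_subset[of _ "Pow {..<n}"]) auto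
    then have "card (guesses i) \<le> card {J. J \<subseteq> {..<n} \<and> card J \<le> g}"
      by (rule card_mono[OF _ guesses_subset])
    then show "card (guesses i) \<le> (n + 1) ^ g" using card_bounded_subsets_le le_trans by blast
  qed
  finally have "card S \<le> m * (n + 1) ^ g" by simp
  then have "(card S + 1) ^ d \<le> (m * (n + 1) ^ g + 1) ^ d" by (intro power_mono) auto
  moreover have "card nodes = (\<Sum>i\<le>d. card S ^ i)"
    unfolding nodes_def S_def[symmetric] by (rule card_lists_length_le[OF S])
  ultimately show ?thesis using sum_power_le[where k = "card S" and d = d] by linarith
qed

definition lift_variables :: "(node \<times> nat) set" where
  "lift_variables = nodes \<times> {..n}"

text \<open>Each branching equality of a node is represented by a single inequality, since the
  opposite one is among the bounds by 0 and by the weight. The equalities with the sums of children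
  take two inequalities each.\<close>

definition node_constraints :: "node \<Rightarrow> ((node \<times> nat \<Rightarrow> real) \<Rightarrow> real) set" where
  "node_constraints s =
    (\<lambda>j y. - y (s, j)) ` {..n} \<union>
    (\<lambda>j y. y (s, j) - (if j \<in> fitting then 1 else 0) * y (s, n)) ` {..<n} \<union>
    (\<lambda>i y. (\<Sum>j<n. a i j * y (s, j)) - y (s, n)) ` {..<m} \<union>
    (case s of [] \<Rightarrow> {} | (i, J) # _ \<Rightarrow>
      (\<lambda>j y. if j \<in> J then y (s, n) - y (s, j) else y (s, j)) ` big i) \<union>
    (if length s < d then
      (\<lambda>(i, j) y. (\<Sum>J\<in>guesses i. y ((i, J) # s, j)) - y (s, j)) ` ({..<m} \<times> {..n}) \<union>
      (\<lambda>(i, j) y. y (s, j) - (\<Sum>J\<in>guesses i. y ((i, J) # s, j))) ` ({..<m} \<times> {..n})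
     else {})"

definition lift_constraints :: "((node \<times> nat \<Rightarrow> real) \<Rightarrow> real) set" where
  "lift_constraints = (\<Union>s\<in>nodes. node_constraints s) \<union> {\<lambda>y. y ([], n) - 1, \<lambda>y. 1 - y ([], n)}"

lemma finite_card_node_constraints:
  "finite (node_constraints s) \<and> card (node_constraints s) \<le> 3 * (n + 1) * (m + 1)"
proof -
  have le: "finite (X \<union> Y) \<and> card (X \<union> Y) \<le> p + q"
    if "finite X \<and> card X \<le> p" "finite Y \<and> card Y \<le> q"
    for X Y :: "((node \<times> nat \<Rightarrow> real) \<Rightarrow> real) set" and p q
    using that card_Un_le[of X Y] by auto
  have im: "finite (f ` X) \<and> card (f ` X) \<le> p" if "finite X" "card X \<le> p"
    for f :: "'x \<Rightarrow> (node \<times> nat \<Rightarrow> real) \<Rightarrow> real" and X p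
    using that card_image_le[of X f] by auto
  have big: "card (big i) \<le> n" for i
    using card_mono[OF _ finite_big(2)] by auto
  \<comment> \<open>The bracketing of the bound mirrors the nested union, so that \<open>le\<close>
    and \<open>im\<close> apply structurally.\<close>
  have "finite (node_constraints s) \<and> card (node_constraints s) \<le>
      ((((n + 1) + n) + m) + n) + (m * (n + 1) + m * (n + 1))"
    unfolding node_constraints_def
  proof (intro le im)
    show "finite (case s of [] \<Rightarrow> {} | (i, J) # _ \<Rightarrow>
        (\<lambda>j y. if j \<in> J then y (s, n) - y (s, j) else y (s, j)) ` big i) \<and>
      card (case s of [] \<Rightarrow> {} | (i, J) # _ \<Rightarrow>
        (\<lambda>j y. if j \<in> J then y (s, n) - y (s, j) else y (s, j)) ` big i) \<le> n"
      by (cases s) (auto simp: finite_big(1) intro!: order_trans[OF card_image_le[OF finite_big(1)] big])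
    let ?F = "\<lambda>(i, j) (y :: node \<times> nat \<Rightarrow> real). (\<Sum>J\<in>guesses i. y ((i, J) # s, j)) - y (s, j)"
    let ?G = "\<lambda>(i, j) (y :: node \<times> nat \<Rightarrow> real). y (s, j) - (\<Sum>J\<in>guesses i. y ((i, J) # s, j))"
    let ?X = "{..<m} \<times> {..n}"
    have "finite (?F ` ?X \<union> ?G ` ?X) \<and> card (?F ` ?X \<union> ?G ` ?X) \<le> m * (n + 1) + m * (n + 1)"
      by (intro le im) (auto simp: card_cartesian_product)
    then show "finite (if length s < d then ?F ` ?X \<union> ?G ` ?X else {}) \<and>
      card (if length s < d then ?F ` ?X \<union> ?G ` ?X else {}) \<le> m * (n + 1) + m * (n + 1)"
      by simp
  qed auto
  moreover have "((((n + 1) + n) + m) + n) + (m * (n + 1) + m * (n + 1)) \<le> 3 * (n + 1) * (m + 1)"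
    by (simp add: algebra_simps)
  ultimately show ?thesis using le_trans by blast
qed

lemma finite_lift_constraints: "finite lift_constraints"
  by (simp add: lift_constraints_def finite_nodes finite_card_node_constraints)

lemma card_lift_constraints_le: "card lift_constraints \<le> card nodes * (3 * (n + 1) * (m + 1)) + 2"
proof -
  have "card (\<Union>s\<in>nodes. node_constraints s) \<le> (\<Sum>s\<in>nodes. card (node_constraints s))"
    by (rule card_UN_le[OF finite_nodes])
  also have "\<dots> \<le> card nodes * (3 * (n + 1) * (m + 1))"
    using sum_bounded_above[of nodes "\<lambda>s. card (node_constraints s)"] finite_card_node_constraints
    by simp
  finally have "card (\<Union>s\<in>nodes. node_constraints s) \<le> card nodes * (3 * (n + 1) * (m + 1))" .
  moreover have "card {\<lambda>y::node \<times> nat \<Rightarrow> real. y ([], n) - 1, \<lambda>y. 1 - y ([], n)} \<le> 2"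
    by (simp add: card_insert_if)
  ultimately show ?thesis
    unfolding lift_constraints_def by (intro order_trans[OF card_Un_le] add_mono)
qed

lemma Nil_in_nodes: "[] \<in> nodes"
  by (simp add: nodes_def)

lemma lift_constraints_affine:
  assumes "L \<in> lift_constraints"
  shows "affine_on lift_variables L"
proof -
  have fin: "finite lift_variables" by (simp add: lift_variables_def finite_nodes)
  have co: "affine_on lift_variables (\<lambda>y. y (s, j))" if "s \<in> nodes" "j \<le> n" for s j
    using that by (intro affine_on_coord[OF fin]) (auto simp: lift_variables_def)
  have "affine_on lift_variables L" if s: "s \<in> nodes" "L \<in> node_constraints s" for s
  proof -
    consider j where "j \<le> n" "L = (\<lambda>y. - y (s, j))"
      | j where "j < n" "L = (\<lambda>y. y (s, j) - (if j \<in> fitting then 1 else 0) * y (s, n))"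
      | i where "i < m" "L = (\<lambda>y. (\<Sum>j<n. a i j * y (s, j)) - y (s, n))"
      | i J s' j where "s = (i, J) # s'" "j \<in> big i"
          "L = (\<lambda>y. if j \<in> J then y (s, n) - y (s, j) else y (s, j))"
      | i j where "length s < d" "i < m" "j \<le> n"
          "L = (\<lambda>y. (\<Sum>J\<in>guesses i. y ((i, J) # s, j)) - y (s, j))"
      | i j where "length s < d" "i < m" "j \<le> n"
          "L = (\<lambda>y. y (s, j) - (\<Sum>J\<in>guesses i. y ((i, J) # s, j)))"
      using s(2) unfolding node_constraints_def
      by (auto split: list.splits if_splits)
    then show ?thesis
    proof cases
      case 1 then show ?thesis using s(1) by (auto intro!: affine_on_intros co)
    next
      case 2 then show ?thesis using s(1) by (auto intro!: affine_on_diff affine_on_scale co)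
    next
      case 3 then show ?thesis using s(1) by (auto intro!: affine_on_diff affine_on_sum affine_on_scale co)
    next
      case 4
      then have "j \<le> n" by (auto simp: big_def)
      then show ?thesis using s(1) 4 by (cases "j \<in> J") (auto intro!: affine_on_diff co)
    next
      case 5 then show ?thesis
        using s(1) Cons_in_nodes[OF s(1)] by (auto intro!: affine_on_diff affine_on_sum co)
    next
      case 6 then show ?thesis
        using s(1) Cons_in_nodes[OF s(1)] by (auto intro!: affine_on_diff affine_on_sum co)
    qed
  qed
  then show ?thesis
    using assms Nil_in_nodes
    by (auto simp: lift_constraints_def intro!: affine_on_diff affine_on_const co)
qed

lemma node_constraints_iff:
  "(\<forall>L\<in>node_constraints s. L y \<le> 0) \<longleftrightarrow>
    (\<forall>j\<le>n. 0 \<le> y (s, j)) \<and>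
    (\<forall>j<n. y (s, j) \<le> (if j \<in> fitting then 1 else 0) * y (s, n)) \<and>
    (\<forall>i<m. (\<Sum>j<n. a i j * y (s, j)) \<le> y (s, n)) \<and>
    (\<forall>i J s'. s = (i, J) # s' \<longrightarrow>
      (\<forall>j\<in>big i. if j \<in> J then y (s, n) \<le> y (s, j) else y (s, j) \<le> 0)) \<and>
    (length s < d \<longrightarrow> (\<forall>i<m. \<forall>j\<le>n. (\<Sum>J\<in>guesses i. y ((i, J) # s, j)) = y (s, j)))"
proof -
  have eq: "r = t \<longleftrightarrow> r - t \<le> 0 \<and> t - r \<le> 0" for r t :: real by auto
  show ?thesis
    unfolding node_constraints_def eq
    by (cases s) (auto simp: ball_Un split: if_splits)
qed

lemma lift_constraints_iff: "(\<forall>L\<in>lift_constraints. L y \<le> 0) \<longleftrightarrow> lift_solution y"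
proof
  assume "\<forall>L\<in>lift_constraints. L y \<le> 0"
  then have N: "\<forall>L\<in>node_constraints s. L y \<le> 0" if "s \<in> nodes" for s
    using that by (auto simp: lift_constraints_def)
  have root: "y ([], n) = 1"
    using \<open>\<forall>L\<in>lift_constraints. L y \<le> 0\<close> by (auto simp: lift_constraints_def)
  note N = N[unfolded node_constraints_iff]
  have "y ((i, J) # s, j) = (if j \<in> J then y ((i, J) # s, n) else 0)"
    if s: "(i, J) # s \<in> nodes" and j: "j \<in> big i" for s i J j
  proof -
    have jn: "j < n" using j by (auto simp: big_def)
    have "0 \<le> y ((i, J) # s, j)" "0 \<le> y ((i, J) # s, n)" using N[OF s] jn by auto
    moreover have "y ((i, J) # s, j) \<le> (if j \<in> fitting then 1 else 0) * y ((i, J) # s, n)"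
      using N[OF s] jn by blast
    moreover have "if j \<in> J then y ((i, J) # s, n) \<le> y ((i, J) # s, j) else y ((i, J) # s, j) \<le> 0"
      using N[OF s] j by blast
    ultimately show ?thesis by (auto split: if_splits)
  qed
  moreover have "0 \<le> y (s, n)" "\<forall>j<n. 0 \<le> y (s, j)" if "s \<in> nodes" for s
    using N[OF that] by auto
  ultimately show "lift_solution y" unfolding lift_solution_def using N root by blast
next
  assume y: "lift_solution y"
  have "\<forall>L\<in>node_constraints s. L y \<le> 0" if s: "s \<in> nodes" for s
  proof -
    have "if j \<in> J then y (s, n) \<le> y (s, j) else y (s, j) \<le> 0"
      if "s = (i, J) # s'" "j \<in> big i" for i J s' j
      using lift_solution_child[OF y, of i J s' j] that s by auto
    moreover have "0 \<le> y (s, j)" if "j \<le> n" for j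
      using lift_solutionD(1,2)[OF y s] that by (cases "j = n") auto
    moreover have "\<forall>j<n. y (s, j) \<le> (if j \<in> fitting then 1 else 0) * y (s, n)"
      using y s unfolding lift_solution_def by blast
    ultimately show ?thesis
      unfolding node_constraints_iff using lift_solutionD(5,6)[OF y s] by blast
  qed
  moreover have "y ([], n) = 1" using y by (simp add: lift_solution_def)
  ultimately show "\<forall>L\<in>lift_constraints. L y \<le> 0" by (auto simp: lift_constraints_def)
qed

text \<open>An integral point puts weight 1 and a copy of itself on every node whose guesses all
  agree with it, and 0 elsewhere. For each row exactly one guess agrees, so children sum to their
  parent.\<close>

lemma integral_lift_solution:
  assumes v: "\<And>j. j < n \<Longrightarrow> v j = 0 \<or> v j = 1"
    and av: "\<And>i. i < m \<Longrightarrow> (\<Sum>j<n. a i j * v j) \<le> 1"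
    and g: "1 / \<theta> \<le> real g"
  shows "\<exists>y. lift_solution y \<and> (\<forall>j<n. y ([], j) = v j)"
proof -
  define T where "T i = {j \<in> big i. v j = 1}" for i
  define agree where "agree s \<longleftrightarrow> (\<forall>(i, J)\<in>set s. J = T i)" for s :: node
  define y where "y = (\<lambda>(s, j). if agree s then if j < n then v j else 1 else 0)"
  have v0: "0 \<le> v j" "v j \<le> 1" if "j < n" for j using v[OF that] by auto
  have T: "T i \<in> guesses i" if i: "i < m" for i
  proof -
    \<comment> \<open>Each chosen large entry uses more than \<theta> of the capacity 1 of the row,
      so \<open>T i\<close> respects the cap \<open>g\<close>.\<close>
    have "real (card (T i)) * \<theta> = (\<Sum>j\<in>T i. \<theta>)" by simp
    also have "\<dots> \<le> (\<Sum>j\<in>T i. a i j * v j)" by (intro sum_mono) (auto simp: T_def big_def)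
    also have "\<dots> \<le> (\<Sum>j<n. a i j * v j)"
      using a_nonneg[OF i] v0 by (intro sum_mono2) (auto simp: T_def big_def)
    also have "\<dots> \<le> 1" by (rule av[OF i])
    finally have "real (card (T i)) \<le> 1 / \<theta>" using theta_pos by (simp add: field_simps)
    then show ?thesis using g by (auto simp: guesses_def T_def)
  qed
  have fit: "j \<in> fitting" if j: "j < n" "v j = 1" for j
  proof -
    have "a i j \<le> 1" if i: "i < m" for i
    proof -
      have "a i j * v j \<le> (\<Sum>j<n. a i j * v j)"
        using a_nonneg[OF i] v0 j by (intro member_le_sum) auto
      then show ?thesis using av[OF i] j by simp
    qed
    then show ?thesis using j by (simp add: fitting_def)
  qed
  have child: "(\<Sum>J\<in>guesses i. y ((i, J) # s, j)) = y (s, j)" if "i < m" for i s j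
  proof -
    have "y ((i, J) # s, j) = (if J = T i then y (s, j) else 0)" for J
      by (auto simp: y_def agree_def)
    then show ?thesis using T[OF that] finite_guesses by (simp add: sum.delta)
  qed
  have "lift_solution y"
    unfolding lift_solution_def
  proof (intro conjI ballI allI impI)
    fix s assume "s \<in> nodes"
    show "0 \<le> y (s, n)" by (simp add: y_def)
    show "0 \<le> y (s, j)" if "j < n" for j using v0[OF that] by (simp add: y_def)
    show "y (s, j) \<le> (if j \<in> fitting then 1 else 0) * y (s, n)" if "j < n" for j
      using v[OF that] fit[OF that] that by (auto simp: y_def)
    show "(\<Sum>j<n. a i j * y (s, j)) \<le> y (s, n)" if "i < m" for i
      using av[OF that] by (cases "agree s") (auto simp: y_def)
    show "(\<Sum>J\<in>guesses i. y ((i, J) # s, j)) = y (s, j)" if "i < m" for i j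
      by (rule child[OF that])
  next
    fix s i J j assume "j \<in> big i"
    then show "y ((i, J) # s, j) = (if j \<in> J then y ((i, J) # s, n) else 0)"
      using v[of j] by (auto simp: y_def agree_def T_def big_def)
  qed (simp add: y_def agree_def)
  moreover have "\<forall>j<n. y ([], j) = v j" by (simp add: y_def agree_def)
  ultimately show ?thesis by blast
qed

end

subsection \<open>Numerical bounds\<close>

text \<open>All quantities are compared with one power \<open>X\<close> of
  \<open>1 / \<epsilon>\<close>: \<open>M\<close> and \<open>1 / \<epsilon>\<close> are at most
  \<open>X\<close>, \<open>g\<close> is linear and \<open>d\<close> is cubic in
  \<open>X\<close>.\<close>

lemma size_exponent_bound:
  fixes \<epsilon> :: real
  assumes \<epsilon>: "0 < \<epsilon>" "\<epsilon> < 1 / 2" and t: "1 \<le> t" and M: "M = 2 ^ t / \<epsilon>"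
    and g: "g = nat \<lceil>4 * M\<rceil>" and d: "d = nat \<lceil>8 * M * (1 + M) / \<epsilon>\<rceil>"
  shows "real ((2 * g + 2) * d + 7) \<le> (1 / \<epsilon>) powr (16 * real t)"
proof -
  define E where "E = 1 / \<epsilon>"
  \<comment> \<open>Since \<open>2 < E\<close>, the factor \<open>2 ^ t\<close> of \<open>M\<close>
    is absorbed by \<open>E ^ t\<close>, and \<open>E\<close> itself by a second factor
    \<open>E ^ t\<close>.\<close>
  define X where "X = E ^ (2 * t)"
  have E: "2 < E" using \<epsilon> by (simp add: E_def field_simps)
  have "E ^ 2 \<le> X" unfolding X_def using E t by (intro power_increasing) auto
  moreover have "2 * 2 \<le> E * E" using E by (intro mult_mono) auto
  ultimately have X4: "4 \<le> X" by (simp add: power2_eq_square)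
  have EX: "E \<le> E ^ t" using power_increasing[of 1 t E] t E by simp
  have Xt: "X = E ^ t * E ^ t" by (simp add: X_def mult_2 power_add)
  have "E ^ t * 1 \<le> X" unfolding Xt using E by (intro mult_left_mono one_le_power) auto
  then have EX': "E \<le> X" using EX by simp
  have "2 ^ t * E \<le> E ^ t * E ^ t" using E EX by (intro mult_mono power_mono) auto
  then have MX: "M \<le> X" by (simp add: M E_def Xt)
  have M0: "0 < M" using \<epsilon> by (simp add: M)
  have "real g \<le> 4 * M + 1" unfolding g using M0 by linarith
  then have gX: "real g \<le> 5 * X" using MX X4 by linarith
  have "8 * M * (1 + M) * E \<le> 8 * X * (1 + X) * X"
    using MX M0 EX' E by (intro mult_mono) auto
  then have "8 * M * (1 + M) / \<epsilon> \<le> 8 * X * (1 + X) * X" by (simp add: E_def)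
  moreover have "0 \<le> 8 * M * (1 + M) / \<epsilon>" using M0 \<epsilon> by simp
  ultimately have dX: "real d \<le> 8 * X * (1 + X) * X + 1" unfolding d by linarith
  have X3: "X ^ 2 * 4 \<le> X ^ 3" using X4 by (simp add: power2_eq_square power3_eq_cube)
  moreover have X2: "16 \<le> X ^ 2" using mult_mono[of 4 X 4 X] X4 by (simp add: power2_eq_square)
  moreover have "8 * X * (1 + X) * X = 8 * X ^ 2 + 8 * X ^ 3"
    by (simp add: power2_eq_square power3_eq_cube algebra_simps)
  ultimately have d3: "real d \<le> 11 * X ^ 3" using dX by linarith
  have "real (2 * g + 2) \<le> 11 * X" using gX X4 by simp
  then have "real (2 * g + 2) * real d \<le> (11 * X) * (11 * X ^ 3)"
    using d3 X4 by (intro mult_mono) auto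
  also have "\<dots> = 121 * X ^ 4" by (simp add: power3_eq_cube power4_eq_xxxx)
  finally have "real ((2 * g + 2) * d + 7) \<le> 121 * X ^ 4 + 7" by (simp only: of_nat_add of_nat_mult)
  moreover have X44: "256 \<le> X ^ 4"
    using power_mono[of 4 X 4] X4 by simp
  moreover have "256 * X ^ 4 \<le> X ^ 4 * X ^ 4" using X44 by (intro mult_right_mono) auto
  \<comment> \<open>The constants are absorbed by squaring \<open>X ^ 4\<close>. The eighth power of
    \<open>E ^ (2 * t)\<close> is the source of the exponent \<open>16 * t\<close>.\<close>
  ultimately have "real ((2 * g + 2) * d + 7) \<le> X ^ 4 * X ^ 4" by linarith
  also have "\<dots> = E ^ (16 * t)" by (simp add: X_def flip: power_mult power_add)
  also have "\<dots> = (1 / \<epsilon>) powr real (16 * t)" using \<epsilon> by (subst powr_realpow) (auto simp: E_def)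
  finally show ?thesis by simp
qed

text \<open>One level of the tree costs a factor \<open>b ^ (2 * g + 2)\<close>; the 7 pays for the
  variables and constraints of a single node and for the two root constraints. The step from
  \<open>n + 1\<close> to \<open>b ^ 2\<close> relies on \<open>b \<ge> 2\<close>.\<close>

lemma formulation_size_bound:
  fixes n m g d :: nat
  assumes "1 \<le> n" "1 \<le> m" and N: "N \<le> (m * (n + 1) ^ g + 1) ^ d" and b: "b = max 2 (n * m)"
  shows "N * (n + 1) \<le> b ^ ((2 * g + 2) * d + 7)"
    "N * (3 * (n + 1) * (m + 1)) + 2 \<le> b ^ ((2 * g + 2) * d + 7)"
proof -
  have b2: "2 \<le> b" by (simp add: b)
  have nb: "n \<le> b" unfolding b by (rule max.coboundedI2) (use assms in simp)
  have mb: "m \<le> b" unfolding b by (rule max.coboundedI2) (use assms in simp)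
  have two: "2 * b \<le> b ^ 2" using b2 by (simp add: power2_eq_square)
  have n1: "n + 1 \<le> b ^ 2" and m1: "m + 1 \<le> b ^ 2" using nb mb two b2 by linarith+
  have b1: "1 \<le> b ^ k" for k using b2 by simp
  have "(n + 1) ^ g \<le> (b ^ 2) ^ g" by (rule power_mono[OF n1]) simp
  then have "m * (n + 1) ^ g \<le> b * (b ^ 2) ^ g" by (intro mult_mono mb) auto
  also have "\<dots> = b ^ (2 * g + 1)" by (simp add: power_mult)
  finally have "m * (n + 1) ^ g + 1 \<le> b ^ (2 * g + 1) * 2" using b1[of "2 * g + 1"] by linarith
  also have "\<dots> \<le> b ^ (2 * g + 1) * b" using b2 by simp
  also have "\<dots> = b ^ (2 * g + 2)" by simp
  finally have "(m * (n + 1) ^ g + 1) ^ d \<le> (b ^ (2 * g + 2)) ^ d" by (rule power_mono) simp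
  then have N': "N \<le> b ^ ((2 * g + 2) * d)" using N by (simp only: power_mult)
  have "N * (n + 1) \<le> b ^ ((2 * g + 2) * d) * b ^ 2" using N' n1 by (rule mult_mono) auto
  also have "\<dots> \<le> b ^ ((2 * g + 2) * d + 7)"
    unfolding power_add[symmetric] using b2 by (intro power_increasing) auto
  finally show "N * (n + 1) \<le> b ^ ((2 * g + 2) * d + 7)" .
  \<comment> \<open>The exponent is one short of the target: the last factor \<open>b\<close> is at
    least 2 and absorbs the summand 2.\<close>
  define X where "X = b ^ ((2 * g + 2) * d + 6)"
  have "3 \<le> b ^ 2" using two b2 by linarith
  then have "3 * (n + 1) * (m + 1) \<le> b ^ 2 * b ^ 2 * b ^ 2" using n1 m1 by (intro mult_mono) auto
  also have "\<dots> = b ^ 6" by (simp flip: power_add)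
  finally have "N * (3 * (n + 1) * (m + 1)) \<le> b ^ ((2 * g + 2) * d) * b ^ 6"
    using N' by (intro mult_mono) auto
  also have "\<dots> = X" unfolding X_def by (simp only: power_add)
  finally have "N * (3 * (n + 1) * (m + 1)) \<le> X" .
  moreover have "b ^ 1 \<le> X" unfolding X_def using b2 by (intro power_increasing) auto
  then have "b \<le> X" by simp
  moreover have "2 * X \<le> b * X" using b2 by (rule mult_le_mono1)
  ultimately have "N * (3 * (n + 1) * (m + 1)) + 2 \<le> b * X" using b2 by linarith
  also have "b * X = b ^ ((2 * g + 2) * d + 7)"
    unfolding X_def power_Suc[symmetric] by (rule arg_cong[of _ _ "\<lambda>k. b ^ k"]) simp
  finally show "N * (3 * (n + 1) * (m + 1)) + 2 \<le> b ^ ((2 * g + 2) * d + 7)" .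
qed

text \<open>The depth makes the decay at most \<open>exp (- (1 + M) / \<epsilon>)\<close>. The part
  \<open>1 / \<epsilon>\<close> cancels \<open>2 powr k\<close>, and the part
  \<open>M / \<epsilon>\<close> outweighs the factor \<open>M\<close> because
  \<open>u \<le> exp u\<close>.\<close>

lemma error_term_bound:
  fixes \<epsilon> k M \<theta> :: real
  assumes \<epsilon>: "0 < \<epsilon>" and M: "1 \<le> M" and \<theta>: "\<theta> = 1 / (4 * M)" and k: "0 \<le> k" "k \<le> 1 / \<epsilon>"
    and d: "8 * M * (1 + M) / \<epsilon> \<le> real d"
  shows "M * 2 powr k * (1 - \<theta> / 2) ^ d \<le> \<epsilon>"
proof -
  have "2 powr k = exp (k * ln 2)" by (simp add: powr_def)
  also have "\<dots> \<le> exp (1 / \<epsilon>)" using k ln_2_less_1 mult_left_le[of "ln 2" k] by simp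
  finally have two: "2 powr k \<le> exp (1 / \<epsilon>)" .
  have "(1 - \<theta> / 2) ^ d \<le> exp (- \<theta> / 2) ^ d"
    using exp_ge_add_one_self[of "- \<theta> / 2"] M \<theta> by (intro power_mono) auto
  also have "\<dots> = exp (- (real d / (8 * M)))" by (simp add: \<theta> flip: exp_of_nat_mult)
  also have "\<dots> \<le> exp (- ((1 + M) / \<epsilon>))"
    using d M \<epsilon> by (simp add: field_simps)
  also have "\<dots> = exp (- (1 / \<epsilon>)) * exp (- (M / \<epsilon>))"
    by (simp add: add_divide_distrib flip: exp_add)
  finally have "M * 2 powr k * (1 - \<theta> / 2) ^ d \<le> M * exp (1 / \<epsilon>) * (exp (- (1 / \<epsilon>)) * exp (- (M / \<epsilon>)))"
    using two M \<theta> by (intro mult_mono) auto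
  also have "\<dots> = M * exp (- (M / \<epsilon>))" by (simp add: exp_minus)
  also have "\<dots> \<le> \<epsilon>"
  proof -
    have "M / \<epsilon> \<le> exp (M / \<epsilon>)" using exp_ge_add_one_self[of "M / \<epsilon>"] by linarith
    then show ?thesis using \<epsilon> by (simp add: exp_minus field_simps)
  qed
  finally show ?thesis .
qed

subsection \<open>The relaxation of a packing polyhedron\<close>

lemma packing_polyhedron_iff:
  assumes "A \<in> carrier_mat m n"
  shows "x \<in> packing_polyhedron A \<longleftrightarrow> x \<in> carrier_vec n \<and> (\<forall>j<n. 0 \<le> x $ j) \<and>
    (\<forall>i<m. (\<Sum>j<n. A $$ (i, j) * x $ j) \<le> 1)"
proof -
  have "(A *\<^sub>v x) $ i = (\<Sum>j<n. A $$ (i, j) * x $ j)" if "i < m" "x \<in> carrier_vec n" for i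
    using that assms scalar_prod_lessThan[OF that(2), of "row A i"] by simp
  then have "A *\<^sub>v x \<le> ones_vec m \<longleftrightarrow> (\<forall>i<m. (\<Sum>j<n. A $$ (i, j) * x $ j) \<le> 1)"
    if "x \<in> carrier_vec n"
    using that assms by (simp add: less_eq_vec_def del: index_mult_mat_vec)
  moreover have "0\<^sub>v n \<le> x \<longleftrightarrow> (\<forall>j<n. 0 \<le> x $ j)" if "x \<in> carrier_vec n"
    using carrier_vecD[OF that] by (simp add: less_eq_vec_def)
  moreover have "dim_row A = m" "dim_col A = n" using assms by auto
  ultimately show ?thesis unfolding packing_polyhedron_def by auto
qed

lemma unit_cube_le_1:
  assumes "x \<in> unit_cube n" "j < n"
  shows "x $ j \<le> 1"
proof -
  have "\<forall>i<dim_vec (ones_vec n). x $ i \<le> ones_vec n $ i"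
    using assms(1) unfolding unit_cube_def less_eq_vec_def by blast
  then show ?thesis using assms(2) by simp
qed

lemma packing_polyhedron_down_closed:
  assumes A: "A \<in> carrier_mat m n" and nonneg: "\<And>i j. i < m \<Longrightarrow> j < n \<Longrightarrow> 0 \<le> A $$ (i, j)"
  shows "down_closed n (packing_polyhedron A)"
proof -
  have "(\<Sum>j<n. A $$ (i, j) * y $ j) \<le> 1"
    if "\<forall>j<n. 0 \<le> y $ j \<and> y $ j \<le> x $ j" "i < m" "(\<Sum>j<n. A $$ (i, j) * x $ j) \<le> 1"
    for i and x y :: "real vec"
  proof -
    have "(\<Sum>j<n. A $$ (i, j) * y $ j) \<le> (\<Sum>j<n. A $$ (i, j) * x $ j)"
      using that nonneg by (intro sum_mono mult_left_mono) auto
    then show ?thesis using that(3) by linarith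
  qed
  then show ?thesis
    unfolding down_closed_def packing_polyhedron_iff[OF A] Ball_def mem_Collect_eq by meson
qed

lemma unit_vec_in_packing_polyhedron_iff:
  assumes A: "A \<in> carrier_mat m n" and j: "j < n"
  shows "unit_vec n j \<in> packing_polyhedron A \<longleftrightarrow> (\<forall>i<m. A $$ (i, j) \<le> 1)"
proof -
  have "(\<Sum>l<n. A $$ (i, l) * unit_vec n j $ l) = A $$ (i, j)" for i
    using j by (subst sum.mono_neutral_right[of _ "{j}"]) (auto simp: unit_vec_def)
  then show ?thesis using j by (simp add: packing_polyhedron_iff[OF A])
qed

text \<open>This is \<open>node_value_bound\<close> at the root, which has weight 1. Integral points
  lie in every closure and supply the bound \<open>k\<close> on feasible sets; the crude inclusion
  of scaled-down points in the closure supplies \<open>M\<close>.\<close>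

lemma small_cut_bound:
  assumes A: "A \<in> carrier_mat m n" and nonneg: "\<And>i j. i < m \<Longrightarrow> j < n \<Longrightarrow> 0 \<le> A $$ (i, j)"
    and \<epsilon>: "0 < \<epsilon>" "\<epsilon> < 1 / 2" and t: "s < t"
    and M: "M = 2 ^ t / \<epsilon>" and \<theta>: "\<theta> = 1 / (4 * M)" and d: "8 * M * (1 + M) / \<epsilon> \<le> real d"
    and sol: "packing_lift.lift_solution (\<lambda>i j. A $$ (i, j)) m n \<theta> g d y"
    and c: "c \<in> int_vecs n" "\<And>j. j < n \<Longrightarrow> 0 \<le> c $ j"
    and valid: "\<And>x. x \<in> iterated_gomory_closure n s (packing_polyhedron A) \<Longrightarrow> c \<bullet> x \<le> \<delta>"
    and k: "\<delta> < real k + 1" "real k \<le> 1 / \<epsilon>"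
  shows "(\<Sum>j<n. c $ j * y ([], j)) \<le> real k + \<epsilon>"
proof -
  define P where "P = packing_polyhedron A"
  define S where "S = iterated_gomory_closure n s P"
  have P: "down_closed n P" unfolding P_def by (rule packing_polyhedron_down_closed[OF A nonneg])
  have "1 \<le> (2 :: real) ^ t" by simp
  then have "\<epsilon> \<le> 2 ^ t" using \<epsilon> by linarith
  then have M1: "1 \<le> M" using \<epsilon> by (simp add: M)
  interpret packing_lift "\<lambda>i j. A $$ (i, j)" m n \<theta> g d
    using nonneg M1 by unfold_locales (auto simp: \<theta>)
  have cZ: "c $ j \<in> \<int>" if "j < n" for j using c(1) that by (simp add: int_vecs_def)
  have fit: "unit_vec n j \<in> P" if "j < n" "j \<in> fitting" for j
    using that unit_vec_in_packing_polyhedron_iff[OF A that(1)] by (simp add: fitting_def P_def)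
  have "(\<Sum>j<n. c $ j * y ([], j)) \<le>
      y ([], n) * (real k + M * 2 powr (real k - (\<Sum>j\<in>tight y []. c $ j)) * (1 - \<theta> / 2) ^ d)"
  proof (rule node_value_bound[OF sol _ _ _ M1 \<theta> Nil_in_nodes])
    show "c $ j = 0 \<or> 1 \<le> c $ j" if "j < n" for j
      using cZ[OF that] c(2)[OF that] by (auto elim!: Ints_cases)
  next
    fix I assume I: "I \<subseteq> {..<n}" "\<And>i. i < m \<Longrightarrow> (\<Sum>j\<in>I. A $$ (i, j)) \<le> 1"
    define v where "v = vec n (\<lambda>j. if j \<in> I then 1 else 0 :: real)"
    have sum_v: "(\<Sum>j<n. f j * v $ j) = (\<Sum>j\<in>I. f j)" for f
      using I(1) by (intro sum.mono_neutral_cong_right) (auto simp: v_def)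
    have "v \<in> P" using I(2) by (auto simp: P_def packing_polyhedron_iff[OF A] sum_v) (auto simp: v_def)
    moreover have "v \<in> int_vecs n" by (simp add: v_def int_vecs_def)
    ultimately have "v \<in> S" unfolding S_def by (rule int_vecs_in_iterated_gomory_closure)
    then have "c \<bullet> v \<le> \<delta>" using valid by (simp add: S_def P_def)
    moreover have "v \<in> carrier_vec n" by (simp add: v_def)
    then have "c \<bullet> v = (\<Sum>j\<in>I. c $ j)" by (simp add: scalar_prod_lessThan[of v n] sum_v)
    moreover have "(\<Sum>j\<in>I. c $ j) \<in> \<int>" using I(1) cZ by (intro Ints_sum) auto
    then obtain z where "(\<Sum>j\<in>I. c $ j) = of_int z" by (auto elim: Ints_cases)
    ultimately have "of_int z < real k + 1" "(\<Sum>j\<in>I. c $ j) = of_int z" using k(1) by auto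
    \<comment> \<open>The value is an integer below \<open>k + 1\<close>; this is where \<delta> is
      rounded down.\<close>
    then have "z < int k + 1" by linarith
    then show "(\<Sum>j\<in>I. c $ j) \<le> real k" using \<open>(\<Sum>j\<in>I. c $ j) = of_int z\<close> by simp
  next
    fix z :: "nat \<Rightarrow> real"
    assume z: "\<And>j. j < n \<Longrightarrow> 0 \<le> z j" "\<And>j. j < n \<Longrightarrow> j \<notin> fitting \<Longrightarrow> z j = 0"
      "\<And>i. i < m \<Longrightarrow> (\<Sum>j<n. A $$ (i, j) * z j) \<le> 1"
    define v where "v = vec n z"
    have v: "v \<in> P" "\<And>j. j < n \<Longrightarrow> v $ j = z j"
      using z by (auto simp: v_def P_def packing_polyhedron_iff[OF A])
    have "(1 / 2) ^ s \<cdot>\<^sub>v v \<in> S"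
      unfolding S_def using z(2) fit v by (intro half_power_in_iterated_gomory_closure[OF P]) auto
    then have "c \<bullet> ((1 / 2) ^ s \<cdot>\<^sub>v v) \<le> \<delta>" using valid by (simp add: S_def P_def)
    moreover have "c \<bullet> ((1 / 2) ^ s \<cdot>\<^sub>v v) = (1 / 2) ^ s * (\<Sum>j<n. c $ j * z j)"
      by (simp add: scalar_prod_lessThan[of _ n] v_def sum_distrib_left algebra_simps)
    ultimately have "(1 / 2) ^ s * (\<Sum>j<n. c $ j * z j) \<le> \<delta>" by simp
    then have "(\<Sum>j<n. c $ j * z j) \<le> 2 ^ s * \<delta>" by (simp add: power_one_over field_simps)
    \<comment> \<open>Here \<open>\<delta> < k + 1 \<le> 2 / \<epsilon>\<close>; the factor 2 is
      then absorbed by \<open>s < t\<close>.\<close>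
    also have "\<dots> \<le> 2 ^ s * (2 / \<epsilon>)"
    proof -
      have "1 \<le> 1 / \<epsilon>" using \<epsilon> by simp
      then have "\<delta> \<le> 2 / \<epsilon>" using k by linarith
      then show ?thesis by (rule mult_left_mono) simp
    qed
    also have "\<dots> = 2 ^ Suc s / \<epsilon>" by simp
    also have "\<dots> \<le> M"
      unfolding M using t \<epsilon> by (intro divide_right_mono power_increasing) auto
    finally show "(\<Sum>j<n. c $ j * z j) \<le> M" .
  qed simp
  also have "\<dots> = real k + M * 2 powr (real k - (\<Sum>j\<in>tight y []. c $ j)) * (1 - \<theta> / 2) ^ d"
    using sol by (simp add: lift_solution_def)
  also have "\<dots> \<le> real k + M * 2 powr real k * (1 - \<theta> / 2) ^ d"
  proof -
    have "0 \<le> (\<Sum>j\<in>tight y []. c $ j)" using c(2) by (intro sum_nonneg) (auto simp: tight_def)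
    moreover have "\<theta> \<le> 1" using M1 by (simp add: \<theta>)
    ultimately show ?thesis using M1 by (intro add_left_mono mult_right_mono mult_left_mono) auto
  qed
  also have "\<dots> \<le> real k + \<epsilon>"
    using error_term_bound[OF \<epsilon>(1) M1 \<theta> _ k(2) d] by simp
  finally show ?thesis .
qed

text \<open>One solution serves all rounds up to \<open>t\<close>, because \<open>M\<close> is taken
  for the last round. Each round divides by \<open>1 + \<epsilon>\<close> once more, which pays
  either for rounding a large right-hand side or for the tree error of a small one.\<close>

lemma lift_solution_in_gomory_closure:
  assumes A: "A \<in> carrier_mat m n" and nonneg: "\<And>i j. i < m \<Longrightarrow> j < n \<Longrightarrow> 0 \<le> A $$ (i, j)"
    and \<epsilon>: "0 < \<epsilon>" "\<epsilon> < 1 / 2"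
    and M: "M = 2 ^ t / \<epsilon>" and \<theta>: "\<theta> = 1 / (4 * M)" and d: "8 * M * (1 + M) / \<epsilon> \<le> real d"
    and sol: "packing_lift.lift_solution (\<lambda>i j. A $$ (i, j)) m n \<theta> g d y"
    and x: "x \<in> carrier_vec n" "\<And>j. j < n \<Longrightarrow> y ([], j) = x $ j"
    and s: "s \<le> t"
  shows "(1 / (1 + \<epsilon>) ^ s) \<cdot>\<^sub>v x \<in> iterated_gomory_closure n s (packing_polyhedron A)"
proof -
  have M0: "0 < M" using \<epsilon> by (simp add: M)
  interpret packing_lift "\<lambda>i j. A $$ (i, j)" m n \<theta> g d
    using nonneg M0 by unfold_locales (auto simp: \<theta>)
  define P where "P = packing_polyhedron A"
  have P: "down_closed n P" unfolding P_def by (rule packing_polyhedron_down_closed[OF A nonneg])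
  note D = lift_solutionD[OF sol Nil_in_nodes]
  have root: "y ([], n) = 1" using sol by (simp add: lift_solution_def)
  have x0: "0 \<le> x $ j" if "j < n" for j using D(2)[OF that] x(2)[OF that] by simp
  have "(\<Sum>j<n. A $$ (i, j) * x $ j) \<le> 1" if "i < m" for i
    using D(5)[OF that] by (simp add: x(2) root)
  then have xP: "x \<in> P" using x(1) x0 by (simp add: P_def packing_polyhedron_iff[OF A])
  have unfit: "x $ j = 0" if "j < n" "j \<notin> fitting" for j using D(4)[OF that] x(2)[OF that(1)] by simp
  have fit: "unit_vec n j \<in> P" if "j < n" "j \<in> fitting" for j
    using that unit_vec_in_packing_polyhedron_iff[OF A that(1)] by (simp add: fitting_def P_def)
  show ?thesis using s unfolding P_def[symmetric]
  proof (induction s)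
    case 0
    then show ?case using xP by (simp add: iterated_gomory_closure_0)
  next
    case (Suc s)
    define S where "S = iterated_gomory_closure n s P"
    define r where "r = (1 + \<epsilon>) ^ s"
    define w where "w = (1 / r) \<cdot>\<^sub>v x"
    define w' where "w' = (1 / (1 + \<epsilon>) ^ Suc s) \<cdot>\<^sub>v x"
    have r1: "1 \<le> r" using \<epsilon> by (simp add: r_def)
    have S: "down_closed n S" unfolding S_def by (rule iterated_gomory_closure_down_closed[OF P])
    have wS: "w \<in> S" using Suc by (simp add: S_def w_def r_def)
    have w'w: "w' $ j = w $ j / (1 + \<epsilon>)" if "j < n" for j
      using that x(1) by (simp add: w'_def w_def r_def)
    have w0: "0 \<le> w $ j" if "j < n" for j using that x(1) x0 r1 by (simp add: w_def)
    have wc: "w \<in> carrier_vec n" "w' \<in> carrier_vec n" using x(1) by (auto simp: w_def w'_def)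
    have "w' \<in> gomory_closure n S"
    proof (rule down_closed_gomory_closureI[OF S, where J = fitting])
      show "unit_vec n j \<in> S" if "j \<in> fitting" "j < n" for j
        unfolding S_def using fit[OF that(2,1)] unit_vec_int
        by (intro int_vecs_in_iterated_gomory_closure) auto
      show "w' \<in> S"
      proof (rule down_closedD(3)[OF S wS wc(2)])
        fix j assume j: "j < n"
        show "0 \<le> w' $ j" using w0[OF j] w'w[OF j] \<epsilon> by simp
        have "w $ j \<le> w $ j * (1 + \<epsilon>)" using w0[OF j] \<epsilon> by (simp add: algebra_simps)
        then show "w' $ j \<le> w $ j" using w'w[OF j] \<epsilon> by (simp add: pos_divide_le_eq)
      qed
      show "w' $ j = 0" if "j < n" "j \<notin> fitting" for j
        using unfit[OF that] that(1) x(1) by (simp add: w'_def)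
      fix c :: "real vec" and \<delta> :: real and k :: nat
      assume c: "c \<in> int_vecs n" "\<And>j. j < n \<Longrightarrow> 0 \<le> c $ j"
        and valid: "\<And>y. y \<in> S \<Longrightarrow> c \<bullet> y \<le> \<delta>" and k: "1 \<le> k" "\<delta> < real k + 1"
      have cw: "c \<bullet> w' = c \<bullet> w / (1 + \<epsilon>)" "c \<bullet> w = (\<Sum>j<n. c $ j * x $ j) / r"
        using wc x(1) w'w
        by (auto simp: scalar_prod_lessThan[of _ n] sum_divide_distrib w_def intro!: sum.cong)
      have "c \<bullet> w \<le> real k * (1 + \<epsilon>)"
      proof (cases "1 / \<epsilon> \<le> real k")
        case True
        \<comment> \<open>Here 1 is at most \<open>k * \<epsilon>\<close>, so the induction
          hypothesis and validity of the cut at \<open>w\<close> suffice.\<close>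
        then have "real k + 1 \<le> real k * (1 + \<epsilon>)" using \<epsilon> by (simp add: field_simps)
        then show ?thesis using valid[OF wS] k(2) by linarith
      next
        case False
        have "(\<Sum>j<n. c $ j * x $ j) = (\<Sum>j<n. c $ j * y ([], j))" using x(2) by simp
        \<comment> \<open>The tree bounds the unscaled point directly; since
          \<open>k \<ge> 1\<close>, the additive \<epsilon> then becomes a factor
          \<open>1 + \<epsilon>\<close>, and shrinking by \<open>r \<ge> 1\<close> only
          helps.\<close>
        also have "\<dots> \<le> real k + \<epsilon>"
          using Suc.prems False
          by (intro small_cut_bound[OF A nonneg \<epsilon> _ M \<theta> d sol c valid k(2), of s]) (auto simp: S_def P_def)
        also have "\<dots> \<le> real k * (1 + \<epsilon>)" using k(1) \<epsilon> by (simp add: algebra_simps)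
        finally have "(\<Sum>j<n. c $ j * x $ j) \<le> real k * (1 + \<epsilon>)" .
        also have "\<dots> \<le> (real k * (1 + \<epsilon>)) * r"
          using mult_left_mono[OF r1, of "real k * (1 + \<epsilon>)"] \<epsilon> by simp
        finally show ?thesis using r1 by (simp add: cw(2) pos_divide_le_eq)
      qed
      then show "c \<bullet> w' \<le> real k" using \<epsilon> by (simp add: cw(1) pos_divide_le_eq)
    qed
    then show ?case by (simp add: iterated_gomory_closure_Suc S_def w'_def)
  qed
qed

text \<open>In dimension 0 the empty vector is integral and satisfies every row, so the whole space
  can serve as the relaxation, with neither variables nor constraints.\<close>

lemma zero_dim_relaxation:
  assumes A: "A \<in> carrier_mat m 0" and "1 \<le> s"
  shows "\<exists>Q. polyhedral_relaxation 0 (packing_polyhedron A) Q \<and>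
    approximates \<alpha> Q (iterated_gomory_closure 0 t (packing_polyhedron A)) \<and>
    has_extended_formulation 0 Q s"
proof (intro exI conjI)
  have C: "carrier_vec 0 = {x \<in> carrier_vec 0. 0\<^sub>m 0 0 *\<^sub>v x \<le> (0\<^sub>v 0 :: real vec)}"
    by (auto simp: less_eq_vec_def)
  have "polyhedron 0 (carrier_vec 0)"
    unfolding polyhedron_def using C zero_carrier_mat[of 0 0] zero_carrier_vec[of 0] by blast
  then show "polyhedral_relaxation 0 (packing_polyhedron A) (carrier_vec 0)"
    by (auto simp: polyhedral_relaxation_def integer_hull_def conv_hull_def)
  have "0\<^sub>v 0 \<in> iterated_gomory_closure 0 t (packing_polyhedron A)"
    by (rule int_vecs_in_iterated_gomory_closure)
      (auto simp: packing_polyhedron_iff[OF A] int_vecs_def)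
  moreover have "x = \<alpha> \<cdot>\<^sub>v 0\<^sub>v 0" if "x \<in> carrier_vec 0" for x using that by (intro eq_vecI) auto
  ultimately show "approximates \<alpha> (carrier_vec 0) (iterated_gomory_closure 0 t (packing_polyhedron A))"
    unfolding approximates_def by blast
  have "carrier_vec 0 = {x \<in> carrier_vec 0. \<exists>y \<in> carrier_vec 0.
      0\<^sub>m 0 0 *\<^sub>v x + 0\<^sub>m 0 0 *\<^sub>v y \<le> (0\<^sub>v 0 :: real vec)}"
    using zero_carrier_vec[of 0] by (auto simp: less_eq_vec_def)
  then show "has_extended_formulation 0 (carrier_vec 0) s"
    unfolding has_extended_formulation_def
    using assms(2) zero_carrier_mat[of 0 0] zero_carrier_vec[of 0]
    by (intro exI[of _ 0] conjI bexI[of _ "0\<^sub>m 0 0"] bexI[of _ "0\<^sub>v 0"]) auto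
qed

lemma packing_relaxation:
  fixes \<epsilon> :: real
  assumes A: "A \<in> carrier_mat m n" and nonneg: "\<And>i j. i < m \<Longrightarrow> j < n \<Longrightarrow> 0 \<le> A $$ (i, j)"
    and cube: "packing_polyhedron A \<subseteq> unit_cube n"
    and n: "1 \<le> n" and \<epsilon>: "0 < \<epsilon>" "\<epsilon> < 1 / 2" and t: "1 \<le> t"
  shows "\<exists>Q. polyhedral_relaxation n (packing_polyhedron A) Q \<and>
    approximates ((1 + \<epsilon>) ^ t) Q (iterated_gomory_closure n t (packing_polyhedron A)) \<and>
    has_extended_formulation n Q (real (max 2 (n * m)) powr ((1 / \<epsilon>) powr (16 * real t)))"
proof -
  define M where "M = 2 ^ t / \<epsilon>"
  define \<theta> where "\<theta> = 1 / (4 * M)"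
  \<comment> \<open>\<open>4 * M\<close> is \<open>1 / \<theta>\<close>, the most large entries of a
    row that an integral point can use. The depth \<open>d\<close> is the one required by
    \<open>error_term_bound\<close>.\<close>
  define g where "g = nat \<lceil>4 * M\<rceil>"
  define d where "d = nat \<lceil>8 * M * (1 + M) / \<epsilon>\<rceil>"
  define b where "b = max 2 (n * m)"
  define B where "B = real b powr ((1 / \<epsilon>) powr (16 * real t))"
  define P where "P = packing_polyhedron A"
  have M0: "0 < M" using \<epsilon> by (simp add: M_def)
  interpret packing_lift "\<lambda>i j. A $$ (i, j)" m n \<theta> g d
    using nonneg M0 by unfold_locales (auto simp: \<theta>_def)
  \<comment> \<open>Without rows the polyhedron would be the whole orthant, which for
    \<open>n \<ge> 1\<close> is not contained in the cube.\<close>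
  have "m \<noteq> 0"
  proof
    assume "m = 0"
    then have "vec n (\<lambda>_. 2 :: real) \<in> packing_polyhedron A" by (simp add: packing_polyhedron_iff[OF A])
    then have "vec n (\<lambda>_. 2) \<in> unit_cube n" using cube by blast
    then have "vec n (\<lambda>_. 2 :: real) $ 0 \<le> 1" using n by (intro unit_cube_le_1) auto
    then show False using n by simp
  qed
  then have m: "1 \<le> m" by simp
  define Q where "Q = solution_shadow n (\<lambda>j. ([] :: node, j)) lift_constraints"
  have Q: "x \<in> Q \<longleftrightarrow> x \<in> carrier_vec n \<and> (\<exists>y. (\<forall>j<n. y ([], j) = x $ j) \<and> lift_solution y)" for x
    by (simp add: Q_def solution_shadow_def lift_constraints_iff)
  have fin: "finite lift_variables" by (simp add: lift_variables_def finite_nodes)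
  have inj: "inj_on (\<lambda>j. ([] :: node, j)) {..<n}" by (simp add: inj_on_def)
  have sub: "(\<lambda>j. ([] :: node, j)) ` {..<n} \<subseteq> lift_variables"
    using Nil_in_nodes by (auto simp: lift_variables_def)
  note shadow = fin inj sub finite_lift_constraints lift_constraints_affine
  have QP: "polyhedron n Q" unfolding Q_def by (rule solution_shadow_polyhedron[OF shadow])
  have "P \<inter> int_vecs n \<subseteq> Q"
  proof
    fix x assume x: "x \<in> P \<inter> int_vecs n"
    then have xc: "x \<in> carrier_vec n" "\<And>j. j < n \<Longrightarrow> 0 \<le> x $ j"
      "\<And>i. i < m \<Longrightarrow> (\<Sum>j<n. A $$ (i, j) * x $ j) \<le> 1"
      by (auto simp: P_def packing_polyhedron_iff[OF A])
    have "x $ j = 0 \<or> x $ j = 1" if j: "j < n" for j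
    proof -
      have "x \<in> unit_cube n" using x cube by (auto simp: P_def)
      then have "x $ j \<le> 1" using j by (rule unit_cube_le_1)
      moreover have "x $ j \<in> \<int>" using x j by (auto simp: int_vecs_def)
      moreover note xc(2)[OF j]
      ultimately show ?thesis by (auto elim!: Ints_cases)
    qed
    moreover have "1 / \<theta> \<le> real g"
    proof -
      have "1 / \<theta> = 4 * M" by (simp add: \<theta>_def)
      then show ?thesis unfolding g_def by linarith
    qed
    ultimately have "\<exists>y. lift_solution y \<and> (\<forall>j<n. y ([], j) = x $ j)"
      using xc(3) by (intro integral_lift_solution) auto
    then show "x \<in> Q" using Q xc(1) by blast
  qed
  then have hull: "integer_hull n P \<subseteq> Q"
    unfolding integer_hull_def by (rule conv_hull_subset_polyhedron[OF QP])
  have approx: "approximates ((1 + \<epsilon>) ^ t) Q (iterated_gomory_closure n t P)"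
    unfolding approximates_def
  proof
    fix x assume "x \<in> Q"
    then obtain y where x: "x \<in> carrier_vec n" and y: "\<And>j. j < n \<Longrightarrow> y ([], j) = x $ j" "lift_solution y"
      using Q by blast
    have d': "8 * M * (1 + M) / \<epsilon> \<le> real d" unfolding d_def by linarith
    have "(1 / (1 + \<epsilon>) ^ t) \<cdot>\<^sub>v x \<in> iterated_gomory_closure n t P"
      unfolding P_def
      by (rule lift_solution_in_gomory_closure[OF A nonneg \<epsilon> M_def \<theta>_def d' y(2) x y(1) order_refl])
    moreover have "x = (1 + \<epsilon>) ^ t \<cdot>\<^sub>v ((1 / (1 + \<epsilon>) ^ t) \<cdot>\<^sub>v x)"
      using \<epsilon> x by (intro eq_vecI) auto
    ultimately show "x \<in> (\<lambda>x. (1 + \<epsilon>) ^ t \<cdot>\<^sub>v x) ` iterated_gomory_closure n t P" by blast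
  qed
  have size: "real k \<le> B" if "k \<le> b ^ ((2 * g + 2) * d + 7)" for k
  proof -
    have "real k \<le> real b ^ ((2 * g + 2) * d + 7)"
      using of_nat_mono[OF that, where 'a = real] by (simp only: of_nat_power)
    also have "\<dots> = real b powr real ((2 * g + 2) * d + 7)"
      by (rule powr_realpow[symmetric]) (simp add: b_def)
    also have "\<dots> \<le> B"
      unfolding B_def using size_exponent_bound[OF \<epsilon> t M_def g_def d_def]
      by (intro powr_mono) (auto simp: b_def)
    finally show ?thesis .
  qed
  have "card lift_variables = card nodes * (n + 1)"
    by (simp add: lift_variables_def card_cartesian_product)
  then have "card lift_variables \<le> b ^ ((2 * g + 2) * d + 7)"
    using formulation_size_bound(1)[OF n m card_nodes_le b_def] by simp
  moreover have "card lift_constraints \<le> b ^ ((2 * g + 2) * d + 7)"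
    using formulation_size_bound(2)[OF n m card_nodes_le b_def] card_lift_constraints_le by linarith
  ultimately have "has_extended_formulation n Q B"
    unfolding Q_def using size by (intro solution_shadow_extended_formulation[OF shadow]) auto
  then show ?thesis
    using QP hull approx unfolding polyhedral_relaxation_def P_def B_def b_def by blast
qed

theorem theorem1:
  shows "\<exists>K::real. K > 0 \<and>
    (\<forall>(\<epsilon>::real) (t::nat) (m::nat) (n::nat) (A::real mat).
       0 < \<epsilon> \<longrightarrow> \<epsilon> < 1 / 2 \<longrightarrow> 1 \<le> t \<longrightarrow>
       A \<in> carrier_mat m n \<longrightarrow> 0\<^sub>m m n \<le> A \<longrightarrow>
       packing_polyhedron A \<subseteq> unit_cube n \<longrightarrow>
       (\<exists>Q. polyhedral_relaxation n (packing_polyhedron A) Q \<and>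
            approximates ((1 + \<epsilon>) ^ t) Q
              (iterated_gomory_closure n t (packing_polyhedron A)) \<and>
            has_extended_formulation n Q
              (real (max 2 (n * m)) powr ((1 / \<epsilon>) powr (K * real t)))))"
\<comment> \<open>The constant 16 comes from \<open>size_exponent_bound\<close>.\<close>
proof (intro exI[of _ 16] conjI allI impI)
  fix \<epsilon> :: real and t m n :: nat and A :: "real mat"
  assume \<epsilon>: "0 < \<epsilon>" "\<epsilon> < 1 / 2" and t: "1 \<le> t" and A: "A \<in> carrier_mat m n"
    and "0\<^sub>m m n \<le> A" and cube: "packing_polyhedron A \<subseteq> unit_cube n"
  then have nonneg: "0 \<le> A $$ (i, j)" if "i < m" "j < n" for i j
    using that by (auto simp: less_eq_mat_def)
  show "\<exists>Q. polyhedral_relaxation n (packing_polyhedron A) Q \<and>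
      approximates ((1 + \<epsilon>) ^ t) Q (iterated_gomory_closure n t (packing_polyhedron A)) \<and>
      has_extended_formulation n Q (real (max 2 (n * m)) powr ((1 / \<epsilon>) powr (16 * real t)))"
  proof (cases "n = 0")
    case True
    have "1 \<le> real (max 2 (n * m)) powr ((1 / \<epsilon>) powr (16 * real t))"
      by (intro ge_one_powr_ge_zero) auto
    then show ?thesis using zero_dim_relaxation A unfolding True by blast
  next
    case False
    then have "1 \<le> n" by simp
    from packing_relaxation[OF A nonneg cube this \<epsilon> t] show ?thesis .
  qed
qed simp

end
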